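(* Let $(M^n,g,e^{-f}dV)$, $m>n\ge3$, $k>0$, $p$, $G$, $s$, $v$, $\mathcal L_f$ be as in the context. Let $U\subset M\setminus\{p\}$ be a connected open set on which $\nabla s\ne0$. Then the quantity $$|\mathring{\mathrm{Hess}}\,s^2|^2+D_m+\bigl(\mathrm{Ric}_f^m-(m-1)kg\bigr)(\nabla s^2,\nabla s^2)$$ vanishes on $U$ if and only if on $U$, with $\psi=\frac{\Delta s^2}{n}$, $$\mathrm{Hess}\,s^2=\psi g,\qquad\langle\nabla f,\nabla s^2\rangle=-(m-n)\psi,\qquad\bigl(\mathrm{Ric}_f^m-(m-1)kg\bigr)(\nabla s^2,\nabla s^2)=0 .$$ Moreover, for every $\beta\ge\frac{m-2}{m-1}$, these conditions are equivalent to $\mathcal L_fv^\beta=0$ on $U$.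
   Context: $(M^n,g)$ is a closed, connected smooth Riemannian manifold, $n\ge3$, $f\in C^\infty(M)$, $m>n$, $k>0$. $\Delta=\mathrm{div}\nabla$, $\Delta_f u=\Delta u-\langle\nabla f,\nabla u\rangle$, $\mathrm{Ric}_f^m=\mathrm{Ric}+\mathrm{Hess}\,f-\frac{df\otimes df}{m-n}$; standing assumption: $\mathrm{Ric}_f^m\ge(m-1)kg$. $p\in M$ is fixed and $G$ is the positive Green function with pole $p$ of $-\Delta_f+\frac{m(m-2)k}{4}$: smooth and positive on $M\setminus\{p\}$, with $\int_M G\,(-\Delta_f\phi+\frac{m(m-2)k}{4}\phi)e^{-f}dV=\kappa\phi(p)$ for all $\phi\in C^\infty(M)$, $\kappa>0$ fixed; in particular $\Delta_fG=\frac{m(m-2)k}{4}G$ on $M\setminus\{p\}$. $s=\frac12G^{1/(2-m)}$, so $G=(2s)^{2-m}$. $v=(4|\nabla s|^2+ks^2)^{1/2}$; $\mathcal L_fu=\Delta_fu+\frac{2-m}{s^2}\langle\nabla s^2,\nabla u\rangle$; $\mathring{\mathrm{Hess}}\,s^2=\mathrm{Hess}\,s^2-\frac{\Delta s^2}{n}g$; $D_m=\frac{n}{m(m-n)}\bigl(\frac{m-n}{n}\Delta s^2+\langle\nabla f,\nabla s^2\rangle\bigr)^2$. *)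

theory Defs
  imports "HOL-Analysis.Analysis"
begin

section \<open>Smooth functions on open subsets of Euclidean space\<close>

definition partial :: "'n::finite \<Rightarrow> (real^'n \<Rightarrow> real) \<Rightarrow> real^'n \<Rightarrow> real" where
  "partial i h y = frechet_derivative h (at y) (axis i 1)"

fun Ck_on :: "nat \<Rightarrow> (real^'n::finite) set \<Rightarrow> (real^'n \<Rightarrow> real) \<Rightarrow> bool" where
  "Ck_on 0 S h \<longleftrightarrow> continuous_on S h"
| "Ck_on (Suc k) S h \<longleftrightarrow>
     (\<forall>y\<in>S. h differentiable (at y)) \<and> (\<forall>i. Ck_on k S (partial i h))"

text \<open>Only used for open \<open>S\<close>.\<close>
definition smooth_on :: "(real^'n::finite) set \<Rightarrow> (real^'n \<Rightarrow> real) \<Rightarrow> bool" where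
  "smooth_on S h \<longleftrightarrow> (\<forall>k. Ck_on k S h)"


section \<open>Smooth manifolds\<close>

text \<open>
  The points of the manifold are all the elements of the type \<open>'a\<close>. A chart is a pair
  consisting of its domain and its coordinate map; the value of the coordinate map outside the
  domain is irrelevant. The dimension is \<open>CARD('n)\<close>.
\<close>
type_synonym ('a, 'n) chart = "'a set \<times> ('a \<Rightarrow> real^'n)"

definition chart_inv :: "('a, 'n) chart \<Rightarrow> real^'n::finite \<Rightarrow> 'a" where
  "chart_inv c = inv_into (fst c) (snd c)"

definition smooth_atlas ::
  "('a::{t2_space, second_countable_topology}, 'n::finite) chart set \<Rightarrow> bool" where
  "smooth_atlas A \<longleftrightarrow>
     (\<forall>c\<in>A. open (fst c) \<and> open (snd c ` fst c) \<and>
             homeomorphism (fst c) (snd c ` fst c) (snd c) (chart_inv c)) \<and>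
     (\<Union>c\<in>A. fst c) = UNIV \<and>
     (\<forall>c\<in>A. \<forall>d\<in>A. \<forall>i. smooth_on (snd c ` (fst c \<inter> fst d)) (\<lambda>y. snd d (chart_inv c y) $ i))"

definition charts_at :: "('a, 'n) chart set \<Rightarrow> 'a \<Rightarrow> ('a, 'n) chart set" where
  "charts_at A x = {c\<in>A. x \<in> fst c}"

text \<open>Scalar invariants at \<open>x\<close> are evaluated in this chart; their values do not depend on the
  choice.\<close>
definition chart_at :: "('a, 'n) chart set \<Rightarrow> 'a \<Rightarrow> ('a, 'n) chart" where
  "chart_at A x = (SOME c. c \<in> charts_at A x)"

text \<open>\<open>S\<close> is always an open subset of the manifold.\<close>
definition smooth_fun_on ::
  "('a, 'n::finite) chart set \<Rightarrow> 'a set \<Rightarrow> ('a \<Rightarrow> real) \<Rightarrow> bool" where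
  "smooth_fun_on A S u \<longleftrightarrow>
     (\<forall>c\<in>A. smooth_on (snd c ` (fst c \<inter> S)) (\<lambda>y. u (chart_inv c y)))"

text \<open>\<open>coord_deriv c i u\<close> is \<open>\<partial>u/\<partial>x\<^sup>i\<close> in the coordinates of \<open>c\<close>,
  as a function on the domain of \<open>c\<close>.\<close>
definition coord_deriv ::
  "('a, 'n::finite) chart \<Rightarrow> 'n \<Rightarrow> ('a \<Rightarrow> real) \<Rightarrow> 'a \<Rightarrow> real" where
  "coord_deriv c i u x = partial i (\<lambda>y. u (chart_inv c y)) (snd c x)"


section \<open>Riemannian metrics\<close>

text \<open>
  Tensors are given by their components in each chart of the atlas: \<open>g c x $ i $ j\<close> is
  \<open>g\<^sub>i\<^sub>j\<close> at the point \<open>x\<close> in the coordinates of \<open>c\<close>. The last clause is the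
  transformation law of a covariant 2-tensor.
\<close>
type_synonym ('a, 'n) tensor2 = "('a, 'n) chart \<Rightarrow> 'a \<Rightarrow> real^'n^'n"

definition riemannian_metric ::
  "('a, 'n::finite) chart set \<Rightarrow> ('a, 'n) tensor2 \<Rightarrow> bool" where
  "riemannian_metric A g \<longleftrightarrow>
     (\<forall>c\<in>A. \<forall>i j. smooth_on (snd c ` fst c) (\<lambda>y. g c (chart_inv c y) $ i $ j)) \<and>
     (\<forall>x. \<forall>c\<in>charts_at A x. transpose (g c x) = g c x \<and>
            (\<forall>X. X \<noteq> 0 \<longrightarrow> X \<bullet> (g c x *v X) > 0)) \<and>
     (\<forall>x. \<forall>c\<in>charts_at A x. \<forall>d\<in>charts_at A x. \<forall>i j.
        g d x $ i $ j =
          (\<Sum>a\<in>UNIV. \<Sum>b\<in>UNIV. g c x $ a $ b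
             * coord_deriv d i (\<lambda>y. snd c y $ a) x * coord_deriv d j (\<lambda>y. snd c y $ b) x))"

definition closed_riemannian_manifold ::
  "('a::{t2_space, second_countable_topology}, 'n::finite) chart set \<Rightarrow> ('a, 'n) tensor2 \<Rightarrow> bool"
where
  "closed_riemannian_manifold A g \<longleftrightarrow>
     smooth_atlas A \<and> riemannian_metric A g \<and> compact (UNIV :: 'a set) \<and> connected (UNIV :: 'a set)"

definition riemannian_volume ::
  "('a::{t2_space, second_countable_topology}, 'n::finite) chart set \<Rightarrow> ('a, 'n) tensor2
     \<Rightarrow> 'a measure \<Rightarrow> bool" where
  "riemannian_volume A g V \<longleftrightarrow> sets V = sets borel \<and>
     (\<forall>c\<in>A. \<forall>B\<in>sets borel. B \<subseteq> fst c \<longrightarrow>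
        emeasure V B =
          (\<integral>\<^sup>+y. ennreal (sqrt (det (g c (chart_inv c y)))) * indicator (snd c ` B) y \<partial>lborel))"


section \<open>Levi-Civita connection and curvature in coordinates\<close>

text \<open>\<open>\<Gamma>\<^sup>l\<^sub>i\<^sub>j\<close>\<close>
definition christoffel ::
  "('a, 'n::finite) tensor2 \<Rightarrow> ('a, 'n) chart \<Rightarrow> 'n \<Rightarrow> 'n \<Rightarrow> 'n \<Rightarrow> 'a \<Rightarrow> real" where
  "christoffel g c l i j x =
     (1/2) * (\<Sum>a\<in>UNIV. matrix_inv (g c x) $ l $ a *
        (coord_deriv c i (\<lambda>y. g c y $ j $ a) x + coord_deriv c j (\<lambda>y. g c y $ i $ a) x
          - coord_deriv c a (\<lambda>y. g c y $ i $ j) x))"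

definition differential :: "('a, 'n::finite) chart \<Rightarrow> ('a \<Rightarrow> real) \<Rightarrow> 'a \<Rightarrow> real^'n" where
  "differential c u x = (\<chi> i. coord_deriv c i u x)"

definition gradient ::
  "('a, 'n::finite) tensor2 \<Rightarrow> ('a, 'n) chart \<Rightarrow> ('a \<Rightarrow> real) \<Rightarrow> 'a \<Rightarrow> real^'n" where
  "gradient g c u x = matrix_inv (g c x) *v differential c u x"

text \<open>Trace of the covariant derivative of the vector field with components \<open>X\<close> in \<open>c\<close>.\<close>
definition divergence ::
  "('a, 'n::finite) tensor2 \<Rightarrow> ('a, 'n) chart \<Rightarrow> ('a \<Rightarrow> real^'n) \<Rightarrow> 'a \<Rightarrow> real" where
  "divergence g c X x =
     (\<Sum>i\<in>UNIV. coord_deriv c i (\<lambda>y. X y $ i) x + (\<Sum>a\<in>UNIV. christoffel g c i i a x * X x $ a))"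

definition hessian ::
  "('a, 'n::finite) tensor2 \<Rightarrow> ('a, 'n) chart \<Rightarrow> ('a \<Rightarrow> real) \<Rightarrow> 'a \<Rightarrow> real^'n^'n" where
  "hessian g c u x =
     (\<chi> i j. coord_deriv c i (coord_deriv c j u) x
        - (\<Sum>l\<in>UNIV. christoffel g c l i j x * coord_deriv c l u x))"

text \<open>\<open>riemann g c l k i j\<close> is the \<open>l\<close>-th component of \<open>R(\<partial>\<^sub>i,\<partial>\<^sub>j)\<partial>\<^sub>k\<close>, where
  \<open>R(X,Y) = [\<nabla>\<^sub>X,\<nabla>\<^sub>Y] - \<nabla>\<^bsub>[X,Y]\<^esub>\<close>, and \<open>Ric(Y,Z)\<close> is the trace of \<open>X \<mapsto> R(X,Y)Z\<close>;
  the round sphere has positive Ricci curvature.\<close>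
definition riemann ::
  "('a, 'n::finite) tensor2 \<Rightarrow> ('a, 'n) chart \<Rightarrow> 'n \<Rightarrow> 'n \<Rightarrow> 'n \<Rightarrow> 'n \<Rightarrow> 'a \<Rightarrow> real" where
  "riemann g c l k i j x =
     coord_deriv c i (christoffel g c l j k) x - coord_deriv c j (christoffel g c l i k) x
     + (\<Sum>a\<in>UNIV. christoffel g c l i a x * christoffel g c a j k x
                  - christoffel g c l j a x * christoffel g c a i k x)"

definition ricci :: "('a, 'n::finite) tensor2 \<Rightarrow> ('a, 'n) tensor2" where
  "ricci g c x = (\<chi> j k. \<Sum>i\<in>UNIV. riemann g c i k i j x)"

definition bilin :: "real^'n^'n \<Rightarrow> real^'n \<Rightarrow> real^'n::finite \<Rightarrow> real" where
  "bilin T X Y = X \<bullet> (T *v Y)"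

text \<open>Scalar functions on the manifold, evaluated pointwise in \<open>chart_at A x\<close>.\<close>

definition grad_inner ::
  "('a, 'n::finite) chart set \<Rightarrow> ('a, 'n) tensor2 \<Rightarrow> ('a \<Rightarrow> real) \<Rightarrow> ('a \<Rightarrow> real) \<Rightarrow> 'a \<Rightarrow> real" where
  "grad_inner A g u w x =
     (let c = chart_at A x in bilin (g c x) (gradient g c u x) (gradient g c w x))"

definition laplacian ::
  "('a, 'n::finite) chart set \<Rightarrow> ('a, 'n) tensor2 \<Rightarrow> ('a \<Rightarrow> real) \<Rightarrow> 'a \<Rightarrow> real" where
  "laplacian A g u x = (let c = chart_at A x in divergence g c (gradient g c u) x)"

text \<open>\<open>|T|\<^sup>2\<close> at \<open>x\<close> for a covariant 2-tensor \<open>T\<close>.\<close>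
definition tensor_norm_sq ::
  "('a, 'n::finite) chart set \<Rightarrow> ('a, 'n) tensor2 \<Rightarrow> ('a, 'n) tensor2 \<Rightarrow> 'a \<Rightarrow> real" where
  "tensor_norm_sq A g T x =
     (let c = chart_at A x; h = matrix_inv (g c x) in
      \<Sum>i\<in>UNIV. \<Sum>j\<in>UNIV. \<Sum>a\<in>UNIV. \<Sum>b\<in>UNIV. h $ i $ a * h $ j $ b * T c x $ i $ j * T c x $ a $ b)"

text \<open>\<open>T(\<nabla>u,\<nabla>u)\<close> at \<open>x\<close>.\<close>
definition eval_grad ::
  "('a, 'n::finite) chart set \<Rightarrow> ('a, 'n) tensor2 \<Rightarrow> ('a, 'n) tensor2 \<Rightarrow> ('a \<Rightarrow> real) \<Rightarrow> 'a \<Rightarrow> real"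
where
  "eval_grad A g T u x =
     (let c = chart_at A x in bilin (T c x) (gradient g c u x) (gradient g c u x))"


section \<open>The weighted manifold and the Green function\<close>

definition weighted_laplacian ::
  "('a, 'n::finite) chart set \<Rightarrow> ('a, 'n) tensor2 \<Rightarrow> ('a \<Rightarrow> real) \<Rightarrow> ('a \<Rightarrow> real) \<Rightarrow> 'a \<Rightarrow> real" where
  "weighted_laplacian A g f u x = laplacian A g u x - grad_inner A g f u x"

definition bakry_emery_ricci ::
  "('a, 'n::finite) tensor2 \<Rightarrow> ('a \<Rightarrow> real) \<Rightarrow> real \<Rightarrow> ('a, 'n) tensor2" where
  "bakry_emery_ricci g f m c x =
     ricci g c x + hessian g c f x
     - (\<chi> i j. coord_deriv c i f x * coord_deriv c j f x / (m - real CARD('n)))"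

text \<open>\<open>Ric\<^sub>f\<^sup>m - (m-1)kg\<close>\<close>
definition curvature_excess ::
  "('a, 'n::finite) tensor2 \<Rightarrow> ('a \<Rightarrow> real) \<Rightarrow> real \<Rightarrow> real \<Rightarrow> ('a, 'n) tensor2" where
  "curvature_excess g f m k c x = bakry_emery_ricci g f m c x - ((m - 1) * k) *\<^sub>R g c x"

text \<open>
  \<open>G\<close> is the positive Green function with pole \<open>p\<close> of \<open>-\<Delta>\<^sub>f + q\<close>, normalised by \<open>\<kappa>\<close>;
  the value \<open>G p\<close> is irrelevant. The last clause is the standard consequence of the preceding one
  (test functions supported away from \<open>p\<close>) and is recorded as part of the notion.
\<close>
definition positive_green_function ::
  "('a::{t2_space, second_countable_topology}, 'n::finite) chart set \<Rightarrow> ('a, 'n) tensor2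
     \<Rightarrow> 'a measure \<Rightarrow> ('a \<Rightarrow> real) \<Rightarrow> real \<Rightarrow> real \<Rightarrow> 'a \<Rightarrow> ('a \<Rightarrow> real) \<Rightarrow> bool" where
  "positive_green_function A g V f q \<kappa> p G \<longleftrightarrow>
     smooth_fun_on A (- {p}) G \<and> (\<forall>x. x \<noteq> p \<longrightarrow> G x > 0) \<and>
     (\<forall>\<phi>. smooth_fun_on A UNIV \<phi> \<longrightarrow>
        has_bochner_integral V
          (\<lambda>x. G x * (- weighted_laplacian A g f \<phi> x + q * \<phi> x) * exp (- f x)) (\<kappa> * \<phi> p)) \<and>
     (\<forall>x. x \<noteq> p \<longrightarrow> weighted_laplacian A g f G x = q * G x)"

definition drift_laplacian ::
  "('a, 'n::finite) chart set \<Rightarrow> ('a, 'n) tensor2 \<Rightarrow> ('a \<Rightarrow> real) \<Rightarrow> real \<Rightarrow> ('a \<Rightarrow> real)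
     \<Rightarrow> ('a \<Rightarrow> real) \<Rightarrow> 'a \<Rightarrow> real" where
  "drift_laplacian A g f m s u x =
     weighted_laplacian A g f u x + (2 - m) / (s x)\<^sup>2 * grad_inner A g (\<lambda>y. (s y)\<^sup>2) u x"

definition traceless_hessian ::
  "('a, 'n::finite) chart set \<Rightarrow> ('a, 'n) tensor2 \<Rightarrow> ('a \<Rightarrow> real) \<Rightarrow> ('a, 'n) tensor2" where
  "traceless_hessian A g u c x =
     hessian g c u x - (laplacian A g u x / real CARD('n)) *\<^sub>R g c x"

text \<open>\<open>D\<^sub>m\<close>, for \<open>w = s\<^sup>2\<close>\<close>
definition weight_defect ::
  "('a, 'n::finite) chart set \<Rightarrow> ('a, 'n) tensor2 \<Rightarrow> ('a \<Rightarrow> real) \<Rightarrow> real \<Rightarrow> ('a \<Rightarrow> real) \<Rightarrow> 'a \<Rightarrow> real"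
where
  "weight_defect A g f m w x =
     (let n = real CARD('n) in
      n / (m * (m - n)) * ((m - n) / n * laplacian A g w x + grad_inner A g f w x)\<^sup>2)"

end

theory Submission
  imports Defs
begin

text \<open>
  Put \<open>w = s\<^sup>2\<close>, \<open>P = |\<nabla>w|\<^sup>2\<close>, \<open>F = v\<^sup>2 = P/w + kw\<close>, and let \<open>Q\<close> be the quantity of the theorem, a sum of
  three nonnegative terms. The equation for \<open>G\<close> becomes \<open>\<Delta>\<^sub>f w = m (F/2 - kw)\<close>, and applying the
  Bochner formula to \<open>wF = P + kw\<^sup>2\<close> gives \<open>w L\<^sub>f F = 2Q\<close>. On the other hand \<open>w \<nabla>F = 2 E(\<nabla>w)\<close> with
  \<open>E = Hess w - (\<Delta>\<^sub>f w / m) g\<close>, and a refined Kato inequality yields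
  \<open>w\<^sup>2 |\<nabla>F|\<^sup>2 \<le> 4 (m - 1)/m Q P\<close>. If \<open>Q = 0\<close>, then \<open>\<nabla>F = 0\<close> and every power of \<open>F\<close> is annihilated by
  \<open>L\<^sub>f\<close>. Conversely \<open>L\<^sub>f F\<^sup>\<gamma> = 0\<close> means \<open>2QF/w = (1 - \<gamma>) |\<nabla>F|\<^sup>2\<close>; for \<open>\<gamma> = \<beta>/2\<close> in the given range the right
  side is at most \<open>2QP/w\<^sup>2 = 2Q (F - kw)/w\<close>, so \<open>k > 0\<close> forces \<open>Q = 0\<close>. The argument is pointwise.
\<close>

section \<open>Calculus of smooth functions\<close>

text \<open>The constants are those of dimension \<open>m\<close>. For integer \<open>m\<close>,
  picture \<open>M\<close> as the base of a warped product with (m - n)-dimensional fibres and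
  warping function e^{-f/(m-n)}. In fibre directions the Hessian of \<open>w\<close> is -<grad f,
  grad w>/(m - n) times the metric, its full trace is the weighted Laplacian, and its trace-free
  part has squared norm equal to the traceless Hessian term plus D_m. The second rigidity equation
  says that the fibre eigenvalue is also \<psi>, and (m - 1)/m is the Kato constant of trace-free
  symmetric matrices of size \<open>m\<close>. The proof reaches these constants by algebra, for
  real \<open>m\<close>. At the threshold for \<beta> the exponent and the Kato constant multiply to
  exactly 2, so the only slack left is the term k w^2 separating P from w F. What shapes the rest is
  that scalar invariants are evaluated in \<open>chart_at A x\<close>, a choice that may jump from
  point to point. A function such as F can be differentiated in a fixed chart only once gradient
  products are known to be independent of the chart, and the Hessian equation must be transferred to
  all charts.\<close>

lemma partial_eq:
  assumes "(h has_derivative D) (at y)"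
  shows "partial i h y = D (axis i 1)"
  unfolding partial_def using frechet_derivative_at[OF assms] by simp

lemma partial_cong:
  assumes "open S" "y \<in> S" "\<And>z. z \<in> S \<Longrightarrow> h z = h' z"
  shows "partial i h y = partial i h' y"
proof -
  have "(h has_derivative D) (at y) \<longleftrightarrow> (h' has_derivative D) (at y)" for D
    using has_derivative_transform_within_open[of h D y UNIV S h'] has_derivative_transform_within_open[of h' D y UNIV S h] assms
    by auto
  then show ?thesis unfolding partial_def frechet_derivative_def by simp
qed

lemma differentiable_cong_open:
  assumes "open S" "y \<in> S" "\<And>z. z \<in> S \<Longrightarrow> h z = h' z" "h differentiable (at y)"
  shows "h' differentiable (at y)"
  using assms unfolding differentiable_def
  by (metis has_derivative_transform_within_open)

lemma Ck_on_cong: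
  assumes "open S" "\<And>z. z \<in> S \<Longrightarrow> h z = h' z"
  shows "Ck_on k S h \<longleftrightarrow> Ck_on k S h'"
  using assms(2)
proof (induction k arbitrary: h h')
  case 0
  then show ?case by (simp cong: continuous_on_cong)
next
  case (Suc k)
  have "Ck_on k S (partial i h) \<longleftrightarrow> Ck_on k S (partial i h')" for i
    using Suc partial_cong[OF assms(1)] by blast
  moreover have "h differentiable (at y) \<longleftrightarrow> h' differentiable (at y)" if "y \<in> S" for y
    using differentiable_cong_open[OF assms(1) that, of h h'] differentiable_cong_open[OF assms(1) that, of h' h] Suc.prems
    by auto
  ultimately show ?case by auto
qed

lemma Ck_on_mono: "Ck_on k S h \<Longrightarrow> T \<subseteq> S \<Longrightarrow> Ck_on k T h"
  by (induction k arbitrary: h) (auto intro: continuous_on_subset)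

lemma Ck_on_SucD: "Ck_on (Suc k) S h \<Longrightarrow> Ck_on k S h"
proof (induction k arbitrary: h)
  case 0
  then show ?case
    by (auto intro!: continuous_at_imp_continuous_on differentiable_imp_continuous_within)
next
  case (Suc k)
  then show ?case by (metis Ck_on.simps(2))
qed

lemma smooth_on_cong:
  assumes "open S" "\<And>z. z \<in> S \<Longrightarrow> h z = h' z"
  shows "smooth_on S h \<longleftrightarrow> smooth_on S h'"
  unfolding smooth_on_def using Ck_on_cong[OF assms] by simp

lemma smooth_on_mono: "smooth_on S h \<Longrightarrow> T \<subseteq> S \<Longrightarrow> smooth_on T h"
  unfolding smooth_on_def using Ck_on_mono by blast

lemma smooth_on_partial: "smooth_on S h \<Longrightarrow> smooth_on S (partial i h)"
  unfolding smooth_on_def by (metis Ck_on.simps(2))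

lemma smooth_on_differentiable: "smooth_on S h \<Longrightarrow> y \<in> S \<Longrightarrow> h differentiable (at y)"
  unfolding smooth_on_def by (metis Ck_on.simps(2))

section \<open>Sums, products and powers of smooth functions\<close>

lemma partial_const: "partial i (\<lambda>z. a) y = 0"
  by (simp add: partial_def)

lemma partial_add:
  assumes "h differentiable (at y)" "h' differentiable (at y)"
  shows "partial i (\<lambda>z. h z + h' z) y = partial i h y + partial i h' y"
  using partial_eq[OF has_derivative_add[OF assms[unfolded frechet_derivative_works]]]
  by (simp add: partial_def)

lemma partial_mult:
  assumes "h differentiable (at y)" "h' differentiable (at y)"
  shows "partial i (\<lambda>z. h z * h' z) y = h y * partial i h' y + partial i h y * h' y"
  using partial_eq[OF has_derivative_mult[OF assms[unfolded frechet_derivative_works]]]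
  by (simp add: partial_def)

lemma partial_compose:
  assumes "h differentiable (at y)" "(\<phi> has_real_derivative d) (at (h y))"
  shows "partial i (\<lambda>z. \<phi> (h z)) y = d * partial i h y"
    "(\<lambda>z. \<phi> (h z)) differentiable (at y)"
proof -
  have D: "((\<lambda>z. \<phi> (h z)) has_derivative (\<lambda>z. d * frechet_derivative h (at y) z)) (at y)"
    using has_derivative_compose[OF assms(1)[unfolded frechet_derivative_works]
        assms(2)[unfolded has_field_derivative_def]]
    by simp
  show "partial i (\<lambda>z. \<phi> (h z)) y = d * partial i h y"
    using partial_eq[OF D] by (simp add: partial_def)
  show "(\<lambda>z. \<phi> (h z)) differentiable (at y)"
    using D by (auto simp: differentiable_def)
qed

lemma Ck_on_const: "Ck_on k S (\<lambda>z. a)"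
proof (induction k arbitrary: a)
  case (Suc k)
  have "partial i (\<lambda>z. a) = (\<lambda>z. 0)" for i :: 'a
    by (rule ext) (rule partial_const)
  with Suc show ?case by simp
qed simp

lemma Ck_on_add:
  assumes "open S" "Ck_on k S h" "Ck_on k S h'"
  shows "Ck_on k S (\<lambda>z. h z + h' z)"
  using assms(2,3)
proof (induction k arbitrary: h h')
  case 0
  then show ?case by (auto intro: continuous_on_add)
next
  case (Suc k)
  have "Ck_on k S (\<lambda>z. partial i h z + partial i h' z)" for i
    using Suc by simp
  then have "Ck_on k S (partial i (\<lambda>z. h z + h' z))" for i
    by (rule Ck_on_cong[OF assms(1), THEN iffD1, rotated]) (use Suc in \<open>auto simp: partial_add\<close>)
  with Suc.prems show ?case by auto
qed

lemma Ck_on_mult: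
  assumes "open S" "Ck_on k S h" "Ck_on k S h'"
  shows "Ck_on k S (\<lambda>z. h z * h' z)"
  using assms(2,3)
proof (induction k arbitrary: h h')
  case 0
  then show ?case by (auto intro: continuous_on_mult)
next
  case (Suc k)
  \<comment> \<open>The product rule leaves one factor undifferentiated, so
    \<open>Ck_on_SucD\<close> has to lower its order of smoothness before the induction hypothesis
    applies.\<close>
  have "Ck_on k S (\<lambda>z. h z * partial i h' z + partial i h z * h' z)" for i
    using Suc.prems Suc.prems[THEN Ck_on_SucD] by (intro Ck_on_add assms(1) Suc.IH) simp_all
  then have "Ck_on k S (partial i (\<lambda>z. h z * h' z))" for i
    by (rule Ck_on_cong[OF assms(1), THEN iffD1, rotated]) (use Suc in \<open>auto simp: partial_mult\<close>)
  with Suc.prems show ?case by auto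
qed

text \<open>The derivative is a power with exponent \<open>a - 1\<close> times a partial derivative
  of \<open>h\<close>, so the induction runs over all exponents at once. Reciprocals and square
  roots of positive functions are covered as powers.\<close>

lemma Ck_on_powr:
  assumes "open S" "Ck_on k S h" "\<And>z. z \<in> S \<Longrightarrow> h z > 0"
  shows "Ck_on k S (\<lambda>z. h z powr a)"
  using assms(2,3)
proof (induction k arbitrary: a)
  case 0
  then show ?case by (auto intro!: continuous_intros simp: less_le)
next
  case (Suc k)
  have D: "((\<lambda>t. t powr a) has_real_derivative a * h z powr (a - 1)) (at (h z))" if "z \<in> S" for z
    using has_real_derivative_powr Suc.prems(2) that by blast
  have "Ck_on k S (\<lambda>z. (a * h z powr (a - 1)) * partial i h z)" for i
    using Suc.prems Suc.prems(1)[THEN Ck_on_SucD] by (intro Ck_on_mult Ck_on_const assms(1) Suc.IH) simp_all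
  moreover have "(a * h z powr (a - 1)) * partial i h z = partial i (\<lambda>z. h z powr a) z"
    if "z \<in> S" for z i
    using partial_compose(1)[where \<phi> = "\<lambda>t. t powr a" and h = h, OF _ D[OF that]] Suc.prems(1) that by simp
  ultimately have "Ck_on k S (partial i (\<lambda>z. h z powr a))" for i
    using Ck_on_cong[OF assms(1)] by (metis (no_types, lifting))
  moreover have "(\<lambda>z. h z powr a) differentiable (at y)" if "y \<in> S" for y
    using Suc.prems(1) partial_compose(2)[where \<phi> = "\<lambda>t. t powr a" and h = h, OF _ D[OF that]] that by auto
  ultimately show ?case by auto
qed

lemma smooth_on_const: "smooth_on S (\<lambda>z. a)"
  by (simp add: smooth_on_def Ck_on_const)

lemma smooth_on_add: "open S \<Longrightarrow> smooth_on S h \<Longrightarrow> smooth_on S h' \<Longrightarrow> smooth_on S (\<lambda>z. h z + h' z)"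
  by (simp add: smooth_on_def Ck_on_add)

lemma smooth_on_mult: "open S \<Longrightarrow> smooth_on S h \<Longrightarrow> smooth_on S h' \<Longrightarrow> smooth_on S (\<lambda>z. h z * h' z)"
  by (simp add: smooth_on_def Ck_on_mult)

lemma smooth_on_powr:
  "open S \<Longrightarrow> smooth_on S h \<Longrightarrow> (\<And>z. z \<in> S \<Longrightarrow> h z > 0) \<Longrightarrow> smooth_on S (\<lambda>z. h z powr a)"
  by (simp add: smooth_on_def Ck_on_powr)

text \<open>The mixed second difference is \<open>t\<^sup>2\<close> times a mixed second derivative at a nearby point;
  its symmetry in \<open>i\<close> and \<open>j\<close> gives the symmetry of second derivatives in the limit.\<close>
lemma second_difference_mvt:
  fixes h :: "real^'n::finite \<Rightarrow> real"
  assumes S: "\<And>z. dist z y \<le> 2 * t \<Longrightarrow> z \<in> S" and "t > 0"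
    and h: "\<And>z. z \<in> S \<Longrightarrow> h differentiable (at z)"
    and h': "\<And>z. z \<in> S \<Longrightarrow> partial i h differentiable (at z)"
  shows "\<exists>z. dist z y \<le> 2 * t \<and>
    h (y + t *\<^sub>R axis i 1 + t *\<^sub>R axis j 1) - h (y + t *\<^sub>R axis i 1) - h (y + t *\<^sub>R axis j 1) + h y
      = t\<^sup>2 * partial j (partial i h) z"
proof -
  let ?z = "\<lambda>a b. y + a *\<^sub>R axis i 1 + b *\<^sub>R axis j (1::real)"
  have near: "dist (?z a b) y \<le> 2 * t" if "0 \<le> a" "a \<le> t" "0 \<le> b" "b \<le> t" for a b
  proof -
    have "dist (?z a b) y = norm (a *\<^sub>R axis i 1 + b *\<^sub>R axis j (1::real))"
      by (simp add: dist_norm add.assoc)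
    also have "\<dots> \<le> norm (a *\<^sub>R axis i (1::real)) + norm (b *\<^sub>R axis j (1::real))"
      by (rule norm_triangle_ineq)
    also have "\<dots> \<le> 2 * t" using that by (simp add: norm_axis_1)
    finally show ?thesis .
  qed
  have line: "((\<lambda>a. q (x0 + a *\<^sub>R axis l 1)) has_real_derivative partial l q (x0 + a *\<^sub>R axis l 1)) (at a)"
    if "q differentiable (at (x0 + a *\<^sub>R axis l 1))" for q x0 a and l :: 'n
  proof -
    have "((\<lambda>a. x0 + a *\<^sub>R axis l (1::real)) has_derivative (\<lambda>b. b *\<^sub>R axis l 1)) (at a)"
      by (auto intro!: derivative_eq_intros)
    from has_derivative_compose[OF this that[unfolded frechet_derivative_works]]
    have "((\<lambda>a. q (x0 + a *\<^sub>R axis l 1)) has_derivative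
        (\<lambda>b. frechet_derivative q (at (x0 + a *\<^sub>R axis l 1)) (b *\<^sub>R axis l 1))) (at a)" .
    moreover have "frechet_derivative q (at (x0 + a *\<^sub>R axis l 1)) (b *\<^sub>R axis l 1)
        = partial l q (x0 + a *\<^sub>R axis l 1) * b" for b
      using linear_frechet_derivative[OF that] by (simp add: partial_def linear_cmul)
    ultimately show ?thesis by (simp add: has_field_derivative_def)
  qed
  \<comment> \<open>\<open>?q\<close> is the difference in direction \<open>j\<close> as a function
    of the step in direction \<open>i\<close>, so \<open>?q t - ?q 0\<close> is the mixed second
    difference. The mean value theorem is used in direction \<open>i\<close> here, and then in
    direction \<open>j\<close> on \<open>partial i h\<close>.\<close>
  let ?q = "\<lambda>a. h (y + t *\<^sub>R axis j 1 + a *\<^sub>R axis i 1) - h (y + a *\<^sub>R axis i 1)"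
  have q: "(?q has_real_derivative partial i h (?z a t) - partial i h (?z a 0)) (at a)"
    if "0 \<le> a" "a \<le> t" for a
  proof -
    have z: "y + t *\<^sub>R axis j 1 + a *\<^sub>R axis i 1 = ?z a t" by (simp add: algebra_simps)
    show ?thesis
      using line[of h "y + t *\<^sub>R axis j 1" a i, unfolded z] line[of h y a i] h[OF S[OF near, of a t]]
        h[OF S[OF near, of a 0]] that \<open>t > 0\<close> by (auto intro!: DERIV_diff)
  qed
  obtain a where a: "0 < a" "a < t"
    "?q t - ?q 0 = (t - 0) * (partial i h (?z a t) - partial i h (?z a 0))"
    using MVT2[OF \<open>t > 0\<close>, of ?q "\<lambda>a. partial i h (?z a t) - partial i h (?z a 0)"] q by blast
  have r: "((\<lambda>b. partial i h (?z a b)) has_real_derivative partial j (partial i h) (?z a b)) (at b)"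
    if "0 \<le> b" "b \<le> t" for b
    using line[of "partial i h" "y + a *\<^sub>R axis i 1" b j] h'[OF S[OF near, of a b]] a that by auto
  obtain b where b: "0 < b" "b < t"
    "partial i h (?z a t) - partial i h (?z a 0) = (t - 0) * partial j (partial i h) (?z a b)"
    using MVT2[OF \<open>t > 0\<close>, of "\<lambda>b. partial i h (?z a b)" "\<lambda>b. partial j (partial i h) (?z a b)"] r
    by blast
  have "?q t - ?q 0 = t\<^sup>2 * partial j (partial i h) (?z a b)"
    using a(3) b(3) by (simp add: power2_eq_square)
  then show ?thesis
    using near[of a b] a b by (intro exI[of _ "?z a b"]) (auto simp: algebra_simps)
qed

lemma partial_commute:
  fixes h :: "real^'n::finite \<Rightarrow> real"
  assumes "open S" "y \<in> S" "smooth_on S h"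
  shows "partial i (partial j h) y = partial j (partial i h) y"
proof (rule ccontr)
  let ?A = "partial i (partial j h)" and ?B = "partial j (partial i h)"
  assume ne: "?A y \<noteq> ?B y"
  \<comment> \<open>Half the gap: a common value \<open>?A z2 = ?B z1\<close> within
    \<open>e\<close> of both \<open>?A y\<close> and \<open>?B y\<close> is impossible.\<close>
  define e where "e = \<bar>?A y - ?B y\<bar> / 2"
  have "e > 0" using ne by (simp add: e_def)
  have "isCont ?A y" "isCont ?B y"
    using assms smooth_on_partial smooth_on_differentiable differentiable_imp_continuous_within
    by blast+
  then obtain d1 d2 where d: "d1 > 0" "d2 > 0"
    "\<And>z. dist z y < d1 \<Longrightarrow> dist (?A z) (?A y) < e" "\<And>z. dist z y < d2 \<Longrightarrow> dist (?B z) (?B y) < e"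
    using \<open>e > 0\<close> unfolding continuous_at_eps_delta by metis
  obtain r where r: "r > 0" "cball y r \<subseteq> S"
    using assms open_contains_cball by blast
  define t where "t = min (min d1 d2) r / 4"
  have t: "t > 0" "2 * t < d1" "2 * t < d2" "2 * t \<le> r"
    using d r by (auto simp: t_def)
  have S: "z \<in> S" if "dist z y \<le> 2 * t" for z
    using that r t by (auto simp: dist_commute subset_iff)
  have dif: "z \<in> S \<Longrightarrow> h differentiable (at z)" "z \<in> S \<Longrightarrow> partial l h differentiable (at z)" for z l
    using assms(3) smooth_on_partial smooth_on_differentiable by blast+
  have swap: "y + t *\<^sub>R axis j 1 + t *\<^sub>R axis i 1 = y + t *\<^sub>R axis i 1 + t *\<^sub>R axis j (1::real)"
    by simp
  obtain z1 where z1: "dist z1 y \<le> 2 * t"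
    "h (y + t *\<^sub>R axis i 1 + t *\<^sub>R axis j 1) - h (y + t *\<^sub>R axis i 1) - h (y + t *\<^sub>R axis j 1) + h y
      = t\<^sup>2 * ?B z1"
    using second_difference_mvt[of y t S h i j, OF S t(1) dif] by blast
  obtain z2 where z2: "dist z2 y \<le> 2 * t"
    "h (y + t *\<^sub>R axis i 1 + t *\<^sub>R axis j 1) - h (y + t *\<^sub>R axis j 1) - h (y + t *\<^sub>R axis i 1) + h y
      = t\<^sup>2 * ?A z2"
    using second_difference_mvt[of y t S h j i, OF S t(1) dif, unfolded swap] by blast
  from z1 z2 have z: "dist z1 y \<le> 2 * t" "dist z2 y \<le> 2 * t" and
    eq: "t\<^sup>2 * ?B z1 = t\<^sup>2 * ?A z2" by linarith+
  then have "?B z1 = ?A z2" using t by simp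
  moreover have "dist (?A z2) (?A y) < e" "dist (?B z1) (?B y) < e"
    using d z t by auto
  ultimately show False unfolding e_def dist_real_def by (smt (verit) field_sum_of_halves)
qed

section \<open>Tensor calculus in a chart\<close>

lemma matrix_inv_mult:
  fixes M :: "real^'n^'n"
  assumes "invertible M"
  shows "M ** matrix_inv M = mat 1" "matrix_inv M ** M = mat 1"
  using someI_ex[OF assms[unfolded invertible_def]] unfolding matrix_inv_def by blast+

lemma matrix_inv_unique:
  fixes M :: "real^'n^'n"
  assumes "M ** N = mat 1"
  shows "matrix_inv M = N"
proof -
  have "invertible M" using assms invertible_right_inverse by blast
  then show ?thesis
    by (metis assms matrix_inv_mult(2) matrix_mul_assoc matrix_mul_lid matrix_mul_rid)
qed

text \<open>The factor \<open>1 / det M\<close> is written with a power of the positive number \<open>(det M)\<^sup>2\<close>, because powers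
  of positive functions are known to be smooth.\<close>
lemma matrix_inv_nth:
  fixes M :: "real^'n^'n"
  assumes "invertible M"
  shows "matrix_inv M $ i $ j = det (\<chi> a b. if b = i then axis j 1 $ a else M $ a $ b) * (det M * (det M * det M) powr - 1)"
proof -
  have d: "det M \<noteq> 0" using assms invertible_det_nz by blast
  have "M *v (matrix_inv M *v axis j 1) = axis j 1"
    by (simp add: matrix_vector_mul_assoc matrix_inv_mult assms)
  then have "(matrix_inv M *v axis j 1) $ i = det (\<chi> a b. if b = i then axis j 1 $ a else M $ a $ b) / det M"
    unfolding cramer[OF d] by simp
  moreover have "(matrix_inv M *v axis j 1) $ i = matrix_inv M $ i $ j"
    by (simp add: matrix_vector_mult_basis column_def)
  ultimately show ?thesis using d by (simp add: powr_minus field_simps)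
qed

lemma posdef_invertible:
  fixes M :: "real^'n^'n"
  assumes "\<And>X. X \<noteq> 0 \<Longrightarrow> X \<bullet> (M *v X) > 0"
  shows "invertible M"
  unfolding invertible_left_inverse matrix_left_invertible_ker
  using assms by (metis inner_zero_right less_irrefl)

lemma matrix_mult_nth: "(M ** N) $ i $ j = (\<Sum>k\<in>UNIV. M $ i $ k * N $ k $ j)"
  by (simp add: matrix_matrix_mult_def)

lemma matrix_mult_uminus_add: "(- (M + N)) ** K = - (M ** K) - N ** (K :: real^'n^'n)"
  by (simp add: vec_eq_iff matrix_mult_nth sum_negf sum_subtractf sum.distrib algebra_simps)

lemma matrix_vector_nth: "(M *v X) $ i = (\<Sum>k\<in>UNIV. M $ i $ k * X $ k)"
  by (simp add: matrix_vector_mult_def)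

lemma transpose_matrix_inv:
  fixes M :: "real^'n^'n"
  assumes "invertible M" "transpose M = M"
  shows "transpose (matrix_inv M) = matrix_inv M"
proof -
  have "M ** transpose (matrix_inv M) = mat 1"
    by (metis assms matrix_inv_mult(2) matrix_transpose_mul transpose_mat)
  then show ?thesis using matrix_inv_unique by metis
qed

lemma inner_matrix_symmetric:
  fixes M :: "real^'n^'n"
  assumes "transpose M = M"
  shows "(M *v X) \<bullet> Y = X \<bullet> (M *v Y)"
  by (metis assms dot_lmul_matrix transpose_matrix_vector)

text \<open>The open set \<open>S\<close> is a parameter, rather than the whole chart domain, so
  that the same calculus serves on the overlap of two charts and on the part of a chart lying in the
  region where the functions are smooth.\<close>

locale chart_domain =
  fixes A :: "('a::{t2_space, second_countable_topology}, 'n::finite) chart set"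
    and g :: "('a, 'n) tensor2" and c :: "('a, 'n) chart" and S :: "'a set"
  assumes atlas: "smooth_atlas A" and metric: "riemannian_metric A g" and chart: "c \<in> A"
    and open_dom: "open S" and dom: "S \<subseteq> fst c"
begin

definition smooth :: "('a \<Rightarrow> real) \<Rightarrow> bool" where
  "smooth u \<longleftrightarrow> smooth_on (snd c ` S) (\<lambda>y. u (chart_inv c y))"

abbreviation D :: "'n \<Rightarrow> ('a \<Rightarrow> real) \<Rightarrow> 'a \<Rightarrow> real" where
  "D \<equiv> coord_deriv c"

lemma homeo: "homeomorphism (fst c) (snd c ` fst c) (snd c) (chart_inv c)"
  and open_fst: "open (fst c)" and open_snd: "open (snd c ` fst c)"
  using bspec[OF conjunct1[OF atlas[unfolded smooth_atlas_def]] chart] by auto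

lemma chart_inv_snd: "x \<in> S \<Longrightarrow> chart_inv c (snd c x) = x"
  using homeomorphism_apply1[OF homeo] dom by auto

lemma open_image: "open (snd c ` S)"
proof -
  have "openin (top_of_set (fst c)) S"
    using dom open_dom by (rule open_subset)
  from homeomorphism_imp_open_map[OF homeo this] open_snd show ?thesis
    by (rule openin_open_trans)
qed

lemma smooth_cong: "(\<And>x. x \<in> S \<Longrightarrow> u x = u' x) \<Longrightarrow> smooth u \<longleftrightarrow> smooth u'"
  unfolding smooth_def using chart_inv_snd by (intro smooth_on_cong[OF open_image]) auto

lemma D_cong: "x \<in> S \<Longrightarrow> (\<And>y. y \<in> S \<Longrightarrow> u y = u' y) \<Longrightarrow> D i u x = D i u' x"
  unfolding coord_deriv_def using chart_inv_snd
  by (intro partial_cong[OF open_image]) auto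

lemma smooth_const: "smooth (\<lambda>x. a)"
  unfolding smooth_def by (rule smooth_on_const)

lemma smooth_add: "smooth u \<Longrightarrow> smooth u' \<Longrightarrow> smooth (\<lambda>x. u x + u' x)"
  unfolding smooth_def by (rule smooth_on_add[OF open_image])

lemma smooth_mult: "smooth u \<Longrightarrow> smooth u' \<Longrightarrow> smooth (\<lambda>x. u x * u' x)"
  unfolding smooth_def by (rule smooth_on_mult[OF open_image])

lemma smooth_uminus: "smooth u \<Longrightarrow> smooth (\<lambda>x. - u x)"
  using smooth_mult[OF smooth_const[of "- 1"]] by simp

lemma smooth_diff: "smooth u \<Longrightarrow> smooth u' \<Longrightarrow> smooth (\<lambda>x. u x - u' x)"
  using smooth_add[OF _ smooth_uminus, of u u'] by simp

lemma smooth_sum: "(\<And>i. i \<in> I \<Longrightarrow> smooth (u i)) \<Longrightarrow> smooth (\<lambda>x. \<Sum>i\<in>I. u i x)"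
  by (induction I rule: infinite_finite_induct) (auto intro: smooth_const smooth_add)

lemma smooth_prod: "(\<And>i. i \<in> I \<Longrightarrow> smooth (u i)) \<Longrightarrow> smooth (\<lambda>x. \<Prod>i\<in>I. u i x)"
  by (induction I rule: infinite_finite_induct) (auto intro: smooth_const smooth_mult)

lemma smooth_powr: "smooth u \<Longrightarrow> (\<And>x. x \<in> S \<Longrightarrow> u x > 0) \<Longrightarrow> smooth (\<lambda>x. u x powr a)"
  unfolding smooth_def by (rule smooth_on_powr[OF open_image]) (use chart_inv_snd in auto)

lemma smooth_D: "smooth u \<Longrightarrow> smooth (D i u)"
  unfolding smooth_def coord_deriv_def
  by (rule smooth_on_cong[OF open_image, THEN iffD1, OF _ smooth_on_partial])
    (auto simp: chart_inv_snd)

lemmas smooth_intros = smooth_const smooth_add smooth_mult smooth_uminus smooth_diff smooth_sum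
  smooth_prod smooth_D

lemma smooth_det: "(\<And>i j. smooth (\<lambda>x. M x $ i $ j)) \<Longrightarrow> smooth (\<lambda>x. det (M x))"
  unfolding det_def by (intro smooth_intros)

lemma smooth_differentiable:
  "smooth u \<Longrightarrow> x \<in> S \<Longrightarrow> (\<lambda>y. u (chart_inv c y)) differentiable (at (snd c x))"
  unfolding smooth_def by (rule smooth_on_differentiable) auto

lemma D_const: "D i (\<lambda>x. a) x = 0"
  by (simp add: coord_deriv_def partial_const)

lemma D_add: "smooth u \<Longrightarrow> smooth u' \<Longrightarrow> x \<in> S \<Longrightarrow> D i (\<lambda>y. u y + u' y) x = D i u x + D i u' x"
  unfolding coord_deriv_def by (intro partial_add smooth_differentiable)

lemma D_mult: "smooth u \<Longrightarrow> smooth u' \<Longrightarrow> x \<in> S \<Longrightarrow>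
    D i (\<lambda>y. u y * u' y) x = u x * D i u' x + D i u x * u' x"
  unfolding coord_deriv_def
  by (subst partial_mult) (auto intro: smooth_differentiable simp: chart_inv_snd)

lemma D_cmult: "smooth u \<Longrightarrow> x \<in> S \<Longrightarrow> D i (\<lambda>y. a * u y) x = a * D i u x"
  using D_mult[OF smooth_const, of u x i a] by (simp add: D_const)

lemma D_diff: "smooth u \<Longrightarrow> smooth u' \<Longrightarrow> x \<in> S \<Longrightarrow> D i (\<lambda>y. u y - u' y) x = D i u x - D i u' x"
  using D_add[OF _ smooth_mult[OF smooth_const], of u u' x i "- 1"] D_cmult[of u' x i "- 1"] by simp

lemma D_sum: "(\<And>j. j \<in> I \<Longrightarrow> smooth (u j)) \<Longrightarrow> x \<in> S \<Longrightarrow>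
    D i (\<lambda>y. \<Sum>j\<in>I. u j y) x = (\<Sum>j\<in>I. D i (u j) x)"
  by (induction I rule: infinite_finite_induct) (auto simp: D_const D_add smooth_sum)

lemma D_compose:
  assumes "smooth u" "x \<in> S" "(\<phi> has_real_derivative d) (at (u x))"
  shows "D i (\<lambda>y. \<phi> (u y)) x = d * D i u x"
  unfolding coord_deriv_def
  using partial_compose(1)[OF smooth_differentiable[OF assms(1,2)], of \<phi> d] assms
  by (simp add: chart_inv_snd)

lemma D_powr:
  assumes "smooth u" "x \<in> S" "u x > 0"
  shows "D i (\<lambda>y. u y powr a) x = (a * u x powr (a - 1)) * D i u x"
  using assms by (intro D_compose[where \<phi> = "\<lambda>t. t powr a"] has_real_derivative_powr)

lemma D_commute:
  assumes "smooth u" "x \<in> S"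
  shows "D i (D j u) x = D j (D i u) x"
proof -
  have "D i (D j u) x = partial i (partial j (\<lambda>y. u (chart_inv c y))) (snd c x)" for i j
    unfolding coord_deriv_def using assms
    by (intro partial_cong[OF open_image]) (auto simp: chart_inv_snd)
  with partial_commute[OF open_image _ assms(1)[unfolded smooth_def]] assms(2) show ?thesis by simp
qed

section \<open>Christoffel symbols and metric compatibility\<close>

abbreviation \<Gamma> :: "'n \<Rightarrow> 'n \<Rightarrow> 'n \<Rightarrow> 'a \<Rightarrow> real" where
  "\<Gamma> \<equiv> christoffel g c"

abbreviation h :: "'a \<Rightarrow> real^'n^'n" where
  "h x \<equiv> matrix_inv (g c x)"

abbreviation X :: "('a \<Rightarrow> real) \<Rightarrow> 'a \<Rightarrow> real^'n" where
  "X \<equiv> gradient g c"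

abbreviation H :: "('a \<Rightarrow> real) \<Rightarrow> 'a \<Rightarrow> real^'n^'n" where
  "H \<equiv> hessian g c"

lemma charts_at: "x \<in> S \<Longrightarrow> c \<in> charts_at A x"
  using chart dom by (auto simp: charts_at_def)

lemma g_transpose: "x \<in> S \<Longrightarrow> transpose (g c x) = g c x"
  and g_pos: "x \<in> S \<Longrightarrow> Y \<noteq> 0 \<Longrightarrow> Y \<bullet> (g c x *v Y) > 0"
  using conjunct1[OF conjunct2[OF metric[unfolded riemannian_metric_def]]] charts_at by auto

lemma g_sym: "x \<in> S \<Longrightarrow> g c x $ i $ j = g c x $ j $ i"
  using arg_cong[OF g_transpose, of x "\<lambda>M. M $ j $ i"] by (simp add: transpose_def)

lemma g_invertible: "x \<in> S \<Longrightarrow> invertible (g c x)"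
  by (rule posdef_invertible) (rule g_pos)

lemma h_transpose: "x \<in> S \<Longrightarrow> transpose (h x) = h x"
  by (intro transpose_matrix_inv g_invertible g_transpose)

lemma h_sym: "x \<in> S \<Longrightarrow> h x $ i $ j = h x $ j $ i"
  using arg_cong[OF h_transpose, of x "\<lambda>M. M $ j $ i"] by (simp add: transpose_def)

lemma smooth_g: "smooth (\<lambda>x. g c x $ i $ j)"
proof -
  have "smooth_on (snd c ` fst c) (\<lambda>y. g c (chart_inv c y) $ i $ j)"
    using conjunct1[OF metric[unfolded riemannian_metric_def]] chart by auto
  then show ?thesis unfolding smooth_def by (rule smooth_on_mono) (use dom in auto)
qed

lemma smooth_h: "smooth (\<lambda>x. h x $ i $ j)"
proof -
  have d: "smooth (\<lambda>x. det (g c x))"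
    by (intro smooth_det smooth_g)
  have "smooth (\<lambda>x. (det (g c x) * det (g c x)) powr - 1)"
    by (intro smooth_powr smooth_mult d)
      (use g_invertible[unfolded invertible_det_nz] not_real_square_gt_zero in blast)
  moreover have "smooth (\<lambda>x. (\<chi> a b. if b = i then axis j 1 $ a else g c x $ a $ b) $ a $ b)" for a b
    by (cases "b = i") (simp_all add: smooth_const smooth_g)
  ultimately have "smooth (\<lambda>x. det (\<chi> a b. if b = i then axis j 1 $ a else g c x $ a $ b)
      * (det (g c x) * (det (g c x) * det (g c x)) powr - 1))"
    by (intro smooth_mult smooth_det d)
  then show ?thesis
    by (rule smooth_cong[THEN iffD1, rotated]) (simp add: matrix_inv_nth g_invertible)
qed

lemma smooth_christoffel: "smooth (\<Gamma> l i j)"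
  unfolding christoffel_def by (intro smooth_intros smooth_h smooth_g)

lemma gradient_nth: "X u x $ i = (\<Sum>j\<in>UNIV. h x $ i $ j * D j u x)"
  by (simp add: gradient_def differential_def matrix_vector_nth)

lemma smooth_gradient: "smooth u \<Longrightarrow> smooth (\<lambda>x. X u x $ i)"
  unfolding gradient_nth by (intro smooth_intros smooth_h)

lemma christoffel_sym: "x \<in> S \<Longrightarrow> \<Gamma> l i j x = \<Gamma> l j i x"
  unfolding christoffel_def
  by (intro arg_cong2[where f = "(*)"] sum.cong refl) (use D_cong[of x "\<lambda>y. g c y $ i $ j" "\<lambda>y. g c y $ j $ i"] g_sym in auto)

lemma christoffel_lower:
  assumes "x \<in> S"
  shows "(\<Sum>l\<in>UNIV. g c x $ b $ l * \<Gamma> l i j x) =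
    (1/2) * (D i (\<lambda>y. g c y $ j $ b) x + D j (\<lambda>y. g c y $ i $ b) x - D b (\<lambda>y. g c y $ i $ j) x)"
proof -
  define Y :: "real^'n" where "Y = (\<chi> a. D i (\<lambda>y. g c y $ j $ a) x + D j (\<lambda>y. g c y $ i $ a) x
    - D a (\<lambda>y. g c y $ i $ j) x)"
  have \<Gamma>: "\<Gamma> l i j x = ((1/2) *\<^sub>R (h x *v Y)) $ l" for l
    by (simp add: christoffel_def Y_def matrix_vector_nth)
  have "(\<Sum>l\<in>UNIV. g c x $ b $ l * \<Gamma> l i j x) = (g c x *v ((1/2) *\<^sub>R (h x *v Y))) $ b"
    unfolding \<Gamma> by (simp only: matrix_vector_nth[of "g c x"])
  also have "\<dots> = (1/2) * Y $ b"
    using matrix_inv_mult(1)[OF g_invertible[OF assms]]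
    by (simp add: matrix_vector_mult_scaleR matrix_vector_mul_assoc)
  finally show ?thesis by (simp add: Y_def)
qed

text \<open>In the sum of the two lowered Christoffel symbols, the derivatives in directions
  \<open>i\<close> and \<open>j\<close> cancel and the two halves of the derivative in direction
  \<open>k\<close> add up.\<close>

lemma D_metric:
  assumes "x \<in> S"
  shows "D k (\<lambda>y. g c y $ i $ j) x =
    (\<Sum>a\<in>UNIV. g c x $ i $ a * \<Gamma> a k j x) + (\<Sum>a\<in>UNIV. g c x $ j $ a * \<Gamma> a k i x)"
proof -
  have "D k (\<lambda>y. g c y $ i $ j) x = D k (\<lambda>y. g c y $ j $ i) x" for k i j
    using assms g_sym by (intro D_cong)
  from this[of i k j] this[of j k i] this[of k i j] show ?thesis
    unfolding christoffel_lower[OF assms] by (simp add: field_simps)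
qed

text \<open>Differentiating the product of \<open>h\<close> and the metric gives
  \<open>dh = - h ** dg ** h\<close>. Once \<open>dg\<close> is expressed by
  \<open>D_metric\<close>, metric and inverse cancel on one side of each term, leaving one
  Christoffel matrix to the left and one to the right of \<open>h\<close>.\<close>

lemma D_inverse_metric:
  assumes x: "x \<in> S"
  shows "D k (\<lambda>y. h y $ i $ j) x =
    - (\<Sum>a\<in>UNIV. \<Gamma> i k a x * h x $ a $ j) - (\<Sum>a\<in>UNIV. \<Gamma> j k a x * h x $ a $ i)"
proof -
  define C :: "real^'n^'n" where "C = (\<chi> a b. \<Gamma> a k b x)"
  define dg :: "real^'n^'n" where "dg = (\<chi> i j. D k (\<lambda>y. g c y $ i $ j) x)"
  define dh :: "real^'n^'n" where "dh = (\<chi> i j. D k (\<lambda>y. h y $ i $ j) x)"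
  note inv = matrix_inv_mult[OF g_invertible[OF x]]
  have dg: "dg = g c x ** C + transpose C ** g c x"
    unfolding dg_def C_def D_metric[OF x]
    by (simp add: vec_eq_iff matrix_mult_nth transpose_def mult.commute g_sym[OF x])
  have "h x ** dg + dh ** g c x = 0"
  proof (simp only: vec_eq_iff, intro allI)
    fix a b
    have "(h x ** dg + dh ** g c x) $ a $ b
        = D k (\<lambda>y. \<Sum>l\<in>UNIV. h y $ a $ l * g c y $ l $ b) x"
      using x by (subst D_sum) (simp_all add: D_mult smooth_mult smooth_h smooth_g matrix_mult_nth dg_def dh_def sum.distrib)
    also have "\<dots> = D k (\<lambda>y. (mat 1 :: real^'n^'n) $ a $ b) x"
      by (rule D_cong[OF x]) (simp only: matrix_mult_nth[symmetric] matrix_inv_mult(2) g_invertible)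
    finally show "(h x ** dg + dh ** g c x) $ a $ b = (0 :: real^'n^'n) $ a $ b" by (simp add: D_const)
  qed
  then have "dh ** g c x = - (h x ** dg)"
    by (simp only: eq_neg_iff_add_eq_0 add.commute)
  also have "h x ** dg = C + h x ** transpose C ** g c x"
    by (simp add: dg matrix_add_ldistrib matrix_mul_assoc inv)
  finally have "(dh ** g c x) ** h x = (- (C + h x ** transpose C ** g c x)) ** h x" by simp
  also have "(dh ** g c x) ** h x = dh"
    by (simp add: inv flip: matrix_mul_assoc)
  also have "(- (C + h x ** transpose C ** g c x)) ** h x = - (C ** h x) - h x ** transpose C ** g c x ** h x"
    by (rule matrix_mult_uminus_add)
  also have "h x ** transpose C ** g c x ** h x = h x ** transpose C"
    by (simp add: inv flip: matrix_mul_assoc)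
  finally have "dh $ i $ j = (- (C ** h x) - h x ** transpose C) $ i $ j" by simp
  then show ?thesis
    by (simp add: dh_def C_def matrix_mult_nth transpose_def h_sym[OF x, of i] mult.commute)
qed

end

section \<open>The Bochner formula\<close>

text \<open>The Bochner identity at one point, reduced to algebra of finite sums.
  \<open>T i k\<close> is the component \<open>i\<close> of the covariant derivative of
  \<open>X\<close> in direction \<open>k\<close>, \<open>G\<close> holds the Christoffel symbols,
  and prefixes \<open>d\<close> mark partial derivatives. The left side is the divergence of the
  covariant derivative of \<open>X\<close> along itself. The identity holds for any vector field;
  the gradient structure enters only in \<open>bochner\<close>.\<close>

lemma bochner_index_identity:
  fixes T X' dX R :: "'n::finite \<Rightarrow> 'n \<Rightarrow> real" and X dL :: "'n \<Rightarrow> real"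
  assumes T: "\<And>i k. T i k = dX k i + (\<Sum>a\<in>UNIV. G i k a * X a)"
    and dT: "\<And>j i k. dT j i k = ddX j k i + (\<Sum>a\<in>UNIV. G i k a * dX j a + dG j i k a * X a)"
    and ddX: "\<And>i j k. ddX i j k = ddX j i k"
    and G: "\<And>l i j. G l i j = G l j i"
    and dL: "\<And>k. dL k = (\<Sum>i\<in>UNIV. ddX k i i + (\<Sum>a\<in>UNIV. G i i a * dX k a + dG k i i a * X a))"
    and R: "\<And>j k. R j k = (\<Sum>i\<in>UNIV. dG i i j k - dG j i i k + (\<Sum>a\<in>UNIV. G i i a * G a j k - G i j a * G a i k))"
  shows "(\<Sum>i\<in>UNIV. (\<Sum>k\<in>UNIV. T i k * dX i k + dT i i k * X k) + (\<Sum>a\<in>UNIV. G i i a * (\<Sum>k\<in>UNIV. T a k * X k)))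
    = (\<Sum>i\<in>UNIV. \<Sum>k\<in>UNIV. T i k * T k i) + (\<Sum>k\<in>UNIV. X k * dL k) + (\<Sum>j\<in>UNIV. \<Sum>k\<in>UNIV. X j * (R j k * X k))"
proof -
  \<comment> \<open>\<open>B\<close> is the divergence of the (1,1) tensor \<open>T\<close>. The
    claim about it is the contracted Ricci identity: swapping two covariant derivatives of
    \<open>X\<close> costs a Ricci term.\<close>
  define B where "B k = (\<Sum>i\<in>UNIV. dT i i k) + (\<Sum>i\<in>UNIV. \<Sum>a\<in>UNIV. G i i a * T a k)
    - (\<Sum>i\<in>UNIV. \<Sum>b\<in>UNIV. T i b * G b i k)" for k
  have B: "B k = dL k + (\<Sum>a\<in>UNIV. R k a * X a)" for k
  proof -
    have "(\<Sum>i\<in>UNIV. \<Sum>b\<in>UNIV. dX b i * G b i k) = (\<Sum>i\<in>UNIV. \<Sum>a\<in>UNIV. G i k a * dX i a)"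
      by (subst sum.swap) (simp add: G[of _ k] mult.commute)
    moreover have "(\<Sum>i\<in>UNIV. \<Sum>b\<in>UNIV. T i b * G b i k) = (\<Sum>i\<in>UNIV. \<Sum>b\<in>UNIV. dX b i * G b i k)
        + (\<Sum>i\<in>UNIV. \<Sum>b\<in>UNIV. \<Sum>a\<in>UNIV. G i b a * G b i k * X a)"
      by (simp add: T algebra_simps sum.distrib sum_distrib_left)
    moreover have "(\<Sum>i\<in>UNIV. \<Sum>b\<in>UNIV. \<Sum>a\<in>UNIV. G i b a * G b i k * X a)
       = (\<Sum>a\<in>UNIV. \<Sum>i\<in>UNIV. \<Sum>b\<in>UNIV. G i k b * G b i a * X a)"
    proof -
      have "(\<Sum>i\<in>UNIV. \<Sum>b\<in>UNIV. \<Sum>a\<in>UNIV. G i b a * G b i k * X a)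
          = (\<Sum>b\<in>UNIV. \<Sum>a\<in>UNIV. \<Sum>i\<in>UNIV. G i b a * G b i k * X a)"
        by (subst sum.swap, rule sum.cong[OF refl], rule sum.swap)
      also have "\<dots> = (\<Sum>a\<in>UNIV. \<Sum>b\<in>UNIV. \<Sum>i\<in>UNIV. G i b a * G b i k * X a)"
        by (rule sum.swap)
      also have "\<dots> = (\<Sum>a\<in>UNIV. \<Sum>b\<in>UNIV. \<Sum>i\<in>UNIV. G b k i * G i b a * X a)"
        by (simp add: G[of _ _ k] mult.commute)
      finally show ?thesis .
    qed
    moreover have "(\<Sum>i\<in>UNIV. \<Sum>a\<in>UNIV. G i i a * T a k) = (\<Sum>i\<in>UNIV. \<Sum>a\<in>UNIV. G i i a * dX k a)
       + (\<Sum>a\<in>UNIV. \<Sum>i\<in>UNIV. \<Sum>b\<in>UNIV. G i i b * G b k a * X a)"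
    proof -
      have "(\<Sum>i\<in>UNIV. \<Sum>a\<in>UNIV. G i i a * T a k) = (\<Sum>i\<in>UNIV. \<Sum>a\<in>UNIV. G i i a * dX k a)
        + (\<Sum>i\<in>UNIV. \<Sum>b\<in>UNIV. \<Sum>a\<in>UNIV. G i i b * G b k a * X a)"
        by (simp add: T distrib_left sum.distrib sum_distrib_left mult.assoc)
      also have "(\<Sum>i\<in>UNIV. \<Sum>b\<in>UNIV. \<Sum>a\<in>UNIV. G i i b * G b k a * X a)
          = (\<Sum>i\<in>UNIV. \<Sum>a\<in>UNIV. \<Sum>b\<in>UNIV. G i i b * G b k a * X a)"
        by (rule sum.cong[OF refl], rule sum.swap)
      also have "\<dots> = (\<Sum>a\<in>UNIV. \<Sum>i\<in>UNIV. \<Sum>b\<in>UNIV. G i i b * G b k a * X a)"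
        by (rule sum.swap)
      finally show ?thesis .
    qed
    moreover have "(\<Sum>i\<in>UNIV. dT i i k) = (\<Sum>i\<in>UNIV. ddX k i i) + (\<Sum>i\<in>UNIV. \<Sum>a\<in>UNIV. G i k a * dX i a)
       + (\<Sum>a\<in>UNIV. \<Sum>i\<in>UNIV. dG i i k a * X a)"
      using ddX[of _ k] by (simp add: dT sum.distrib sum.swap[of "\<lambda>i a. dG i i k a * X a"])
    moreover have "dL k = (\<Sum>i\<in>UNIV. ddX k i i) + (\<Sum>i\<in>UNIV. \<Sum>a\<in>UNIV. G i i a * dX k a)
       + (\<Sum>a\<in>UNIV. \<Sum>i\<in>UNIV. dG k i i a * X a)"
      by (simp add: dL sum.distrib sum.swap[of "\<lambda>i a. dG k i i a * X a"])
    moreover have "(\<Sum>a\<in>UNIV. R k a * X a) = (\<Sum>a\<in>UNIV. \<Sum>i\<in>UNIV. dG i i k a * X a)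
      - (\<Sum>a\<in>UNIV. \<Sum>i\<in>UNIV. dG k i i a * X a)
      + (\<Sum>a\<in>UNIV. \<Sum>i\<in>UNIV. \<Sum>b\<in>UNIV. G i i b * G b k a * X a)
      - (\<Sum>a\<in>UNIV. \<Sum>i\<in>UNIV. \<Sum>b\<in>UNIV. G i k b * G b i a * X a)"
      by (simp add: R sum_distrib_right sum.distrib sum_subtractf distrib_right left_diff_distrib)
    ultimately show ?thesis unfolding B_def by simp
  qed
  \<comment> \<open>Trading the partial derivative \<open>dX i k\<close> for the tensor component
    \<open>T k i\<close> releases the Christoffel term that completes \<open>B\<close>.\<close>
  have "T i k * dX i k = T i k * T k i - (\<Sum>a\<in>UNIV. T i k * G k i a * X a)" for i k
    unfolding T[of k i] by (simp add: distrib_left sum_distrib_left mult.assoc)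
  then have "(\<Sum>i\<in>UNIV. (\<Sum>k\<in>UNIV. T i k * dX i k + dT i i k * X k) + (\<Sum>a\<in>UNIV. G i i a * (\<Sum>k\<in>UNIV. T a k * X k)))
    = (\<Sum>i\<in>UNIV. \<Sum>k\<in>UNIV. T i k * T k i) - (\<Sum>i\<in>UNIV. \<Sum>k\<in>UNIV. \<Sum>a\<in>UNIV. T i k * G k i a * X a)
     + (\<Sum>i\<in>UNIV. \<Sum>k\<in>UNIV. dT i i k * X k) + (\<Sum>i\<in>UNIV. \<Sum>a\<in>UNIV. \<Sum>k\<in>UNIV. G i i a * T a k * X k)"
    by (simp add: sum.distrib sum_subtractf sum_distrib_left mult.assoc)
  also have "(\<Sum>i\<in>UNIV. \<Sum>k\<in>UNIV. \<Sum>a\<in>UNIV. T i k * G k i a * X a) = (\<Sum>a\<in>UNIV. \<Sum>i\<in>UNIV. \<Sum>k\<in>UNIV. T i k * G k i a * X a)"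
    by (rule trans[OF sum.cong[OF refl sum.swap] sum.swap])
  also have "(\<Sum>i\<in>UNIV. \<Sum>k\<in>UNIV. dT i i k * X k) = (\<Sum>k\<in>UNIV. \<Sum>i\<in>UNIV. dT i i k * X k)"
    by (rule sum.swap)
  also have "(\<Sum>i\<in>UNIV. \<Sum>a\<in>UNIV. \<Sum>k\<in>UNIV. G i i a * T a k * X k) = (\<Sum>k\<in>UNIV. \<Sum>i\<in>UNIV. \<Sum>a\<in>UNIV. G i i a * T a k * X k)"
    by (rule trans[OF sum.cong[OF refl sum.swap] sum.swap])
  also have "(\<Sum>i\<in>UNIV. \<Sum>k\<in>UNIV. T i k * T k i) - (\<Sum>a\<in>UNIV. \<Sum>i\<in>UNIV. \<Sum>k\<in>UNIV. T i k * G k i a * X a)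
     + (\<Sum>k\<in>UNIV. \<Sum>i\<in>UNIV. dT i i k * X k) + (\<Sum>k\<in>UNIV. \<Sum>i\<in>UNIV. \<Sum>a\<in>UNIV. G i i a * T a k * X k)
     = (\<Sum>i\<in>UNIV. \<Sum>k\<in>UNIV. T i k * T k i) + (\<Sum>k\<in>UNIV. X k * B k)"
    unfolding B_def
    by (simp add: sum.distrib sum_subtractf sum_distrib_right right_diff_distrib distrib_left mult.commute[of "X _"])
  also have "(\<Sum>k\<in>UNIV. X k * B k) = (\<Sum>k\<in>UNIV. X k * dL k) + (\<Sum>j\<in>UNIV. \<Sum>k\<in>UNIV. X j * (R j k * X k))"
    by (simp add: B distrib_left sum.distrib sum_distrib_left)
  finally show ?thesis by simp
qed


section \<open>Gradient, Hessian and Laplacian in a chart\<close>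

context chart_domain
begin

abbreviation du :: "('a \<Rightarrow> real) \<Rightarrow> 'a \<Rightarrow> real^'n" where
  "du \<equiv> differential c"

text \<open>The form of the gradient product with a single inverse metric, convenient for
  differentiation; \<open>metric_gradient\<close> converts it to the form in
  \<open>grad_inner\<close>.\<close>

definition ip :: "('a \<Rightarrow> real) \<Rightarrow> ('a \<Rightarrow> real) \<Rightarrow> 'a \<Rightarrow> real" where
  "ip u u' x = X u x \<bullet> du u' x"

definition L :: "('a \<Rightarrow> real) \<Rightarrow> 'a \<Rightarrow> real" where
  "L u x = divergence g c (X u) x"

lemma differential_nth: "du u x $ i = D i u x"
  by (simp add: differential_def)

lemma metric_gradient: "x \<in> S \<Longrightarrow> g c x *v X u x = du u x"
  using matrix_inv_mult(1)[OF g_invertible] by (simp add: gradient_def matrix_vector_mul_assoc)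

lemma ip_sym: "x \<in> S \<Longrightarrow> ip u u' x = ip u' u x"
  unfolding ip_def gradient_def
  by (subst inner_matrix_symmetric[OF h_transpose]) (simp_all add: inner_commute)

lemma ip_sum: "ip u u' x = (\<Sum>i\<in>UNIV. X u x $ i * D i u' x)"
  by (simp add: ip_def inner_vec_def differential_nth)

lemma smooth_ip: "smooth u \<Longrightarrow> smooth u' \<Longrightarrow> smooth (ip u u')"
  unfolding ip_sum[abs_def] by (intro smooth_intros smooth_gradient)

lemma hessian_nth: "H u x $ i $ j = D i (D j u) x - (\<Sum>l\<in>UNIV. \<Gamma> l i j x * D l u x)"
  by (simp add: hessian_def)

lemma hessian_sym: "smooth u \<Longrightarrow> x \<in> S \<Longrightarrow> H u x $ i $ j = H u x $ j $ i"
  by (simp add: hessian_nth D_commute[of u x i j] christoffel_sym[of x _ i j])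

lemma hessian_transpose: "smooth u \<Longrightarrow> x \<in> S \<Longrightarrow> transpose (H u x) = H u x"
  by (simp add: vec_eq_iff transpose_def hessian_sym[of u])

text \<open>Of the two Christoffel sums produced by \<open>D_inverse_metric\<close>, one cancels the
  connection term on the left and the other turns the second partial derivatives into the
  Hessian.\<close>

lemma covariant_gradient:
  assumes u: "smooth u" and x: "x \<in> S"
  shows "D k (\<lambda>y. X u y $ i) x + (\<Sum>a\<in>UNIV. \<Gamma> i k a x * X u x $ a) = (h x ** H u x) $ i $ k"
proof -
  have "D k (\<lambda>y. X u y $ i) x = (\<Sum>j\<in>UNIV. h x $ i $ j * D k (D j u) x + D k (\<lambda>y. h y $ i $ j) x * D j u x)"
    unfolding gradient_nth using u x
    by (subst D_sum) (auto intro: smooth_mult smooth_h smooth_D simp: D_mult smooth_h smooth_D)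
  also have "\<dots> = (\<Sum>j\<in>UNIV. h x $ i $ j * D k (D j u) x)
      - (\<Sum>j\<in>UNIV. \<Sum>a\<in>UNIV. \<Gamma> i k a x * h x $ a $ j * D j u x)
      - (\<Sum>j\<in>UNIV. \<Sum>a\<in>UNIV. \<Gamma> j k a x * h x $ a $ i * D j u x)"
    by (simp add: D_inverse_metric[OF x] sum.distrib sum_subtractf left_diff_distrib sum_distrib_right sum_negf)
  also have "(\<Sum>j\<in>UNIV. \<Sum>a\<in>UNIV. \<Gamma> i k a x * h x $ a $ j * D j u x) = (\<Sum>a\<in>UNIV. \<Gamma> i k a x * X u x $ a)"
    by (subst sum.swap) (simp add: gradient_nth sum_distrib_left mult.assoc)
  also have "(\<Sum>j\<in>UNIV. \<Sum>a\<in>UNIV. \<Gamma> j k a x * h x $ a $ i * D j u x)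
      = (\<Sum>j\<in>UNIV. h x $ i $ j * (\<Sum>l\<in>UNIV. \<Gamma> l k j x * D l u x))"
    by (subst sum.swap) (simp add: sum_distrib_left h_sym[OF x] mult.assoc mult.left_commute)
  finally show ?thesis
    by (simp add: matrix_mult_nth hessian_sym[OF u x, of _ k] hessian_nth[of _ _ k] right_diff_distrib sum_subtractf)
qed

lemma L_trace:
  assumes "smooth u" "x \<in> S"
  shows "L u x = trace (h x ** H u x)"
  by (simp add: L_def divergence_def trace_def covariant_gradient[OF assms])

lemma D_ip:
  assumes u: "smooth u" "smooth u'" and x: "x \<in> S"
  shows "D k (ip u u') x = (H u x *v X u' x) $ k + (H u' x *v X u x) $ k"
proof -
  have "D k (ip u u') x = (\<Sum>i\<in>UNIV. X u x $ i * D k (D i u') x + D k (\<lambda>y. X u y $ i) x * D i u' x)"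
    unfolding ip_sum[abs_def] using u x
    by (subst D_sum) (auto intro: smooth_mult smooth_gradient smooth_D simp: D_mult smooth_gradient smooth_D)
  also have "\<dots> = (\<Sum>i\<in>UNIV. X u x $ i * D k (D i u') x)
      + (\<Sum>i\<in>UNIV. (h x ** H u x) $ i $ k * D i u' x)
      - (\<Sum>i\<in>UNIV. \<Sum>a\<in>UNIV. \<Gamma> i k a x * X u x $ a * D i u' x)"
    by (simp add: sum.distrib sum_subtractf left_diff_distrib sum_distrib_right flip: covariant_gradient[OF u(1) x])
      (simp add: algebra_simps sum.distrib sum_distrib_left)
  also have "(\<Sum>i\<in>UNIV. \<Sum>a\<in>UNIV. \<Gamma> i k a x * X u x $ a * D i u' x)
      = (\<Sum>a\<in>UNIV. X u x $ a * (\<Sum>i\<in>UNIV. \<Gamma> i k a x * D i u' x))"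
    by (subst sum.swap) (simp add: sum_distrib_left mult.assoc mult.left_commute)
  also have "(\<Sum>i\<in>UNIV. (h x ** H u x) $ i $ k * D i u' x) = (\<Sum>j\<in>UNIV. \<Sum>i\<in>UNIV. h x $ i $ j * H u x $ j $ k * D i u' x)"
    by (subst sum.swap) (simp add: matrix_mult_nth sum_distrib_right)
  also have "\<dots> = (H u x *v X u' x) $ k"
    by (simp add: matrix_vector_nth gradient_nth sum_distrib_left h_sym[OF x] hessian_sym[OF u(1) x, of _ k] mult.assoc mult.left_commute)
  finally show ?thesis
    by (simp add: matrix_vector_nth hessian_nth[of _ _ k] algebra_simps sum_subtractf)
qed

lemma ricci_nth: "ricci g c x $ j $ k = (\<Sum>i\<in>UNIV. D i (\<Gamma> i j k) x - D j (\<Gamma> i i k) x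
     + (\<Sum>a\<in>UNIV. \<Gamma> i i a x * \<Gamma> a j k x - \<Gamma> i j a x * \<Gamma> a i k x))"
  by (simp add: ricci_def riemann_def)

lemma gradient_ip_self:
  assumes u: "smooth u" and x: "x \<in> S"
  shows "X (ip u u) x = 2 *\<^sub>R ((h x ** H u x) *v X u x)"
proof -
  have "du (ip u u) x = 2 *\<^sub>R (H u x *v X u x)"
    by (simp add: vec_eq_iff differential_nth D_ip[OF u u x])
  then show ?thesis
    by (simp add: gradient_def[of _ _ "ip u u"] matrix_vector_mult_scaleR matrix_vector_mul_assoc)
qed

text \<open>By \<open>gradient_ip_self\<close> the gradient of \<open>ip u u\<close> is twice the
  covariant derivative of \<open>X u\<close> along itself, so \<open>bochner_index_identity\<close>
  evaluates half of its divergence.\<close>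

lemma bochner:
  assumes u: "smooth u" and x: "x \<in> S"
  shows "L (ip u u) x = 2 * ((\<Sum>i\<in>UNIV. \<Sum>k\<in>UNIV. (h x ** H u x) $ i $ k * (h x ** H u x) $ k $ i)
    + ip u (L u) x + bilin (ricci g c x) (X u x) (X u x))"
proof -
  \<comment> \<open>\<open>T\<close> is introduced by its coordinate formula, not as
    \<open>h ** H u\<close>, so that its partial derivatives unfold into those of the gradient and
    of the Christoffel symbols, as the index identity requires.\<close>
  define T where "T i k y = D k (\<lambda>y. X u y $ i) y + (\<Sum>a\<in>UNIV. \<Gamma> i k a y * X u y $ a)" for i k y
  have T: "T i k y = (h y ** H u y) $ i $ k" if "y \<in> S" for i k y
    unfolding T_def by (rule covariant_gradient[OF u that])
  have sX: "smooth (\<lambda>y. X u y $ i)" for i by (rule smooth_gradient[OF u])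
  have sT: "smooth (T i k)" for i k
    unfolding T_def[abs_def] by (intro smooth_intros sX smooth_christoffel)
  have XP: "X (ip u u) y $ i = 2 * (\<Sum>k\<in>UNIV. T i k y * X u y $ k)" if "y \<in> S" for y i
    by (simp add: gradient_ip_self[OF u that] T[OF that] matrix_vector_nth)
  have DXP: "D i (\<lambda>y. X (ip u u) y $ i) x
      = 2 * (\<Sum>k\<in>UNIV. T i k x * D i (\<lambda>y. X u y $ k) x + D i (T i k) x * X u x $ k)" for i
  proof -
    have "D i (\<lambda>y. X (ip u u) y $ i) x = D i (\<lambda>y. 2 * (\<Sum>k\<in>UNIV. T i k y * X u y $ k)) x"
      using XP by (intro D_cong[OF x])
    then show ?thesis
      using x sX sT by (simp add: D_cmult D_sum D_mult smooth_sum smooth_mult)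
  qed
  have "L (ip u u) x = (\<Sum>i\<in>UNIV. 2 * (\<Sum>k\<in>UNIV. T i k x * D i (\<lambda>y. X u y $ k) x + D i (T i k) x * X u x $ k)
      + (\<Sum>a\<in>UNIV. \<Gamma> i i a x * (2 * (\<Sum>k\<in>UNIV. T a k x * X u x $ k))))"
    by (simp add: L_def divergence_def DXP XP[OF x])
  also have "\<dots> = 2 * (\<Sum>i\<in>UNIV. (\<Sum>k\<in>UNIV. T i k x * D i (\<lambda>y. X u y $ k) x + D i (T i k) x * X u x $ k)
      + (\<Sum>a\<in>UNIV. \<Gamma> i i a x * (\<Sum>k\<in>UNIV. T a k x * X u x $ k)))"
    by (simp add: sum_distrib_left distrib_left mult.left_commute)
  also have "\<dots> = 2 * ((\<Sum>i\<in>UNIV. \<Sum>k\<in>UNIV. T i k x * T k i x) + (\<Sum>k\<in>UNIV. X u x $ k * D k (L u) x)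
      + (\<Sum>j\<in>UNIV. \<Sum>k\<in>UNIV. X u x $ j * (ricci g c x $ j $ k * X u x $ k)))"
  proof (rule arg_cong[where f = "(*) 2"], rule bochner_index_identity[where T = "\<lambda>i k. T i k x"
        and dX = "\<lambda>i k. D i (\<lambda>y. X u y $ k) x" and dT = "\<lambda>j i k. D j (T i k) x"
        and ddX = "\<lambda>j k i. D j (D k (\<lambda>y. X u y $ i)) x" and G = "\<lambda>l i j. \<Gamma> l i j x"
        and dG = "\<lambda>j l i k. D j (\<Gamma> l i k) x" and X = "\<lambda>i. X u x $ i" and dL = "\<lambda>k. D k (L u) x"
        and R = "\<lambda>j k. ricci g c x $ j $ k"])
    show "T i k x = D k (\<lambda>y. X u y $ i) x + (\<Sum>a\<in>UNIV. \<Gamma> i k a x * X u x $ a)" for i k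
      by (rule T_def)
    show "D j (T i k) x = D j (D k (\<lambda>y. X u y $ i)) x
        + (\<Sum>a\<in>UNIV. \<Gamma> i k a x * D j (\<lambda>y. X u y $ a) x + D j (\<Gamma> i k a) x * X u x $ a)" for j i k
      unfolding T_def[abs_def] using x sX
      by (simp add: D_add D_sum D_mult smooth_sum smooth_mult smooth_D smooth_christoffel)
    show "D j (D k (\<lambda>y. X u y $ i)) x = D k (D j (\<lambda>y. X u y $ i)) x" for i j k
      using D_commute[OF sX x] .
    show "\<Gamma> l i j x = \<Gamma> l j i x" for l i j by (rule christoffel_sym[OF x])
    show "D k (L u) x = (\<Sum>i\<in>UNIV. D k (D i (\<lambda>y. X u y $ i)) x
        + (\<Sum>a\<in>UNIV. \<Gamma> i i a x * D k (\<lambda>y. X u y $ a) x + D k (\<Gamma> i i a) x * X u x $ a))" for k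
      unfolding L_def[abs_def] divergence_def using x sX
      by (simp add: D_add D_sum D_mult smooth_add smooth_sum smooth_mult smooth_D smooth_christoffel)
  qed (rule ricci_nth)
  finally show ?thesis
    by (simp add: T[OF x] ip_sum bilin_def inner_vec_def matrix_vector_nth sum_distrib_left)
qed

section \<open>Product and chain rules for gradient products and the Laplacian\<close>

lemma differential_mult: "smooth u \<Longrightarrow> smooth u' \<Longrightarrow> x \<in> S \<Longrightarrow> du (\<lambda>y. u y * u' y) x = u x *\<^sub>R du u' x + u' x *\<^sub>R du u x"
  by (simp add: vec_eq_iff differential_nth D_mult)

lemma gradient_mult: "smooth u \<Longrightarrow> smooth u' \<Longrightarrow> x \<in> S \<Longrightarrow> X (\<lambda>y. u y * u' y) x = u x *\<^sub>R X u' x + u' x *\<^sub>R X u x"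
  by (simp add: gradient_def differential_mult matrix_vector_right_distrib matrix_vector_mult_scaleR)

lemma ip_mult: "smooth u \<Longrightarrow> smooth u' \<Longrightarrow> x \<in> S \<Longrightarrow>
    ip v (\<lambda>y. u y * u' y) x = u x * ip v u' x + u' x * ip v u x"
  by (simp add: ip_def differential_mult inner_add_right)

lemma ip_add: "smooth u \<Longrightarrow> smooth u' \<Longrightarrow> x \<in> S \<Longrightarrow> ip v (\<lambda>y. u y + u' y) x = ip v u x + ip v u' x"
  by (simp add: ip_sum D_add distrib_left sum.distrib)

lemma ip_diff: "smooth u \<Longrightarrow> smooth u' \<Longrightarrow> x \<in> S \<Longrightarrow> ip v (\<lambda>y. u y - u' y) x = ip v u x - ip v u' x"
  by (simp add: ip_sum D_diff right_diff_distrib sum_subtractf)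

lemma ip_cmult: "smooth u \<Longrightarrow> x \<in> S \<Longrightarrow> ip v (\<lambda>y. a * u y) x = a * ip v u x"
  by (simp add: ip_sum D_cmult sum_distrib_left mult.left_commute)

lemma divergence_cong:
  "x \<in> S \<Longrightarrow> (\<And>y. y \<in> S \<Longrightarrow> Y y = Z y) \<Longrightarrow> divergence g c Y x = divergence g c Z x"
  unfolding divergence_def
  by (intro sum.cong arg_cong2[where f = "(+)"] refl D_cong) auto

lemma divergence_add:
  assumes "\<And>i. smooth (\<lambda>y. Y y $ i)" "\<And>i. smooth (\<lambda>y. Z y $ i)" "x \<in> S"
  shows "divergence g c (\<lambda>y. Y y + Z y) x = divergence g c Y x + divergence g c Z x"
  using assms by (simp add: divergence_def D_add distrib_left sum.distrib)

lemma divergence_scaleR: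
  assumes "\<And>i. smooth (\<lambda>y. Y y $ i)" "smooth u" "x \<in> S"
  shows "divergence g c (\<lambda>y. u y *\<^sub>R Y y) x = u x * divergence g c Y x + Y x \<bullet> du u x"
  using assms by (simp add: divergence_def D_mult distrib_left sum.distrib sum_distrib_left
      inner_vec_def differential_nth mult.commute mult.left_commute)

lemma L_cong: "x \<in> S \<Longrightarrow> (\<And>y. y \<in> S \<Longrightarrow> u y = u' y) \<Longrightarrow> L u x = L u' x"
  unfolding L_def gradient_def differential_def
  using D_cong[of _ u u'] by (intro divergence_cong) auto

lemma L_mult:
  assumes u: "smooth u" "smooth u'" and x: "x \<in> S"
  shows "L (\<lambda>y. u y * u' y) x = u x * L u' x + u' x * L u x + 2 * ip u u' x"
proof -
  have "L (\<lambda>y. u y * u' y) x = divergence g c (\<lambda>y. u y *\<^sub>R X u' y + u' y *\<^sub>R X u y) x"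
    unfolding L_def using u by (intro divergence_cong[OF x] gradient_mult)
  also have "\<dots> = u x * L u' x + u' x * L u x + X u' x \<bullet> du u x + X u x \<bullet> du u' x"
    using u x by (simp add: divergence_add divergence_scaleR smooth_mult smooth_gradient L_def)
  finally show ?thesis
    using ip_sym[OF x, of u u'] by (simp add: ip_def)
qed

lemma L_add: "smooth u \<Longrightarrow> smooth u' \<Longrightarrow> x \<in> S \<Longrightarrow> L (\<lambda>y. u y + u' y) x = L u x + L u' x"
proof -
  assume u: "smooth u" "smooth u'" and x: "x \<in> S"
  have "L (\<lambda>y. u y + u' y) x = divergence g c (\<lambda>y. X u y + X u' y) x"
    unfolding L_def using u
    by (intro divergence_cong[OF x]) (simp add: gradient_def differential_def D_add vec_eq_iff
        matrix_vector_nth distrib_left sum.distrib)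
  then show ?thesis using u x by (simp add: divergence_add smooth_gradient L_def)
qed

lemma L_cmult: "smooth u \<Longrightarrow> x \<in> S \<Longrightarrow> L (\<lambda>y. a * u y) x = a * L u x"
  using L_mult[OF smooth_const, of u x a] L_mult[OF smooth_const smooth_const, of x a 0]
  by (simp add: ip_sum L_def divergence_def gradient_nth D_const)

lemma ip_powr:
  assumes "smooth u" "x \<in> S" "u x > 0"
  shows "ip v (\<lambda>y. u y powr a) x = (a * u x powr (a - 1)) * ip v u x"
  using assms by (simp add: ip_sum D_powr sum_distrib_left mult.left_commute)

lemma L_powr:
  assumes u: "smooth u" and pos: "\<And>y. y \<in> S \<Longrightarrow> u y > 0" and x: "x \<in> S"
  shows "L (\<lambda>y. u y powr a) x = a * u x powr (a - 1) * L u x + a * (a - 1) * u x powr (a - 2) * ip u u x"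
proof -
  have s: "smooth (\<lambda>y. u y powr (a - 1))" using u pos by (rule smooth_powr)
  have "L (\<lambda>y. u y powr a) x = divergence g c (\<lambda>y. (a * u y powr (a - 1)) *\<^sub>R X u y) x"
    unfolding L_def using u pos
    by (intro divergence_cong[OF x]) (simp add: gradient_def differential_def D_powr vec_eq_iff
        matrix_vector_nth sum_distrib_left mult.left_commute)
  also have "\<dots> = a * u x powr (a - 1) * L u x + X u x \<bullet> du (\<lambda>y. a * u y powr (a - 1)) x"
    using u x s by (subst divergence_scaleR) (simp_all add: smooth_gradient smooth_mult smooth_const L_def)
  also have "X u x \<bullet> du (\<lambda>y. a * u y powr (a - 1)) x = a * ip u (\<lambda>y. u y powr (a - 1)) x"
    using ip_cmult[OF s x] by (simp add: ip_def)
  finally show ?thesis using u pos x by (simp add: ip_powr)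
qed

end

section \<open>The refined Kato inequality\<close>

lemma bilin_axis: "bilin M (axis i 1) (axis j 1) = M $ i $ j"
  by (simp add: bilin_def matrix_vector_mult_basis column_def inner_axis')

lemma bilin_eqI: "(\<And>Y Z. bilin M Y Z = bilin N Y Z) \<Longrightarrow> M = N"
  unfolding vec_eq_iff by (metis bilin_axis)

lemma bilin_congruence: "bilin (transpose J ** M ** J) Y Z = bilin M (J *v Y) (J *v Z)"
proof -
  have "Y \<bullet> (transpose J *v W) = (J *v Y) \<bullet> W" for W
    using dot_lmul_matrix[of W J Y] by (simp add: inner_commute)
  then show ?thesis
    unfolding bilin_def by (simp only: matrix_vector_mul_assoc[symmetric])
qed

text \<open>Gram-Schmidt for the inner product of \<open>M\<close>, by induction on the set of
  indices already treated. Indexing by the type \<open>'n\<close> lets the finished frame be read as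
  the columns of a square matrix.\<close>

lemma gram_schmidt:
  fixes M :: "real^'n^'n"
  assumes sym: "transpose M = M" and pos: "\<And>Y. Y \<noteq> 0 \<Longrightarrow> Y \<bullet> (M *v Y) > 0"
  shows "\<exists>b :: 'n \<Rightarrow> real^'n. \<forall>i\<in>I. \<forall>j\<in>I. b i \<bullet> (M *v b j) = (if i = j then 1 else 0)"
proof (induction I rule: finite_induct[OF finite])
  case (2 k I)
  then obtain b :: "'n \<Rightarrow> real^'n"
    where b: "\<forall>i\<in>I. \<forall>j\<in>I. b i \<bullet> (M *v b j) = (if i = j then 1 else 0)" by blast
  \<comment> \<open>\<open>k\<close> is not yet in \<open>I\<close>, so fewer than
    \<open>CARD('n)\<close> vectors have been chosen and they cannot span.\<close>
  have "card (b ` I) < CARD('n)"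
  proof -
    have "I \<subset> UNIV" using 2(2) by auto
    then have "card I < CARD('n)" by (rule psubset_card_mono[OF finite])
    then show ?thesis using card_image_le[of I b] by simp
  qed
  then have "dim (b ` I) < CARD('n)"
    using dim_le_card'[of "b ` I"] by simp
  then have "span (b ` I) \<noteq> UNIV"
    by (metis DIM_cart DIM_real dim_UNIV dim_span mult.right_neutral less_irrefl)
  then obtain v where v: "v \<notin> span (b ` I)" by blast
  define z where "z = v - (\<Sum>i\<in>I. (b i \<bullet> (M *v v)) *\<^sub>R b i)"
  have "(\<Sum>i\<in>I. (b i \<bullet> (M *v v)) *\<^sub>R b i) \<in> span (b ` I)"
    by (intro span_sum span_scale span_base) auto
  then have "z \<noteq> 0" using v unfolding z_def by auto
  then have q: "z \<bullet> (M *v z) > 0" by (rule pos)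
  have orth: "z \<bullet> (M *v b j) = 0" if "j \<in> I" for j
  proof -
    have "z \<bullet> (M *v b j) = v \<bullet> (M *v b j) - (\<Sum>i\<in>I. (b i \<bullet> (M *v v)) * (b i \<bullet> (M *v b j)))"
      by (simp add: z_def inner_diff_left inner_sum_left)
    also have "(\<Sum>i\<in>I. (b i \<bullet> (M *v v)) * (b i \<bullet> (M *v b j))) = (\<Sum>i\<in>I. if i = j then b j \<bullet> (M *v v) else 0)"
      using b that by (intro sum.cong) auto
    also have "\<dots> = b j \<bullet> (M *v v)" using that by simp
    finally show ?thesis
      using inner_matrix_symmetric[OF sym, of "b j" v] by (simp add: inner_commute)
  qed
  have orth': "b j \<bullet> (M *v z) = 0" if "j \<in> I" for j
    using orth[OF that] inner_matrix_symmetric[OF sym, of "b j" z] by (simp add: inner_commute)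
  define b' where "b' = b(k := (1 / sqrt (z \<bullet> (M *v z))) *\<^sub>R z)"
  have bk: "b' k = (1 / sqrt (z \<bullet> (M *v z))) *\<^sub>R z" and bI: "i \<in> I \<Longrightarrow> b' i = b i" for i
    using 2(2) by (auto simp: b'_def)
  have one: "(1 / sqrt (z \<bullet> (M *v z))) * ((1 / sqrt (z \<bullet> (M *v z))) * (z \<bullet> (M *v z))) = 1"
    using q by (simp add: field_simps)
  have "b' i \<bullet> (M *v b' j) = (if i = j then 1 else 0)" if "i \<in> insert k I" "j \<in> insert k I" for i j
    using that 2(2) b one orth orth'
    by (cases "i = k"; cases "j = k") (auto simp: bk bI matrix_vector_mult_scaleR)
  then show ?case by blast
qed simp

text \<open>A left inverse of a square matrix is also a right inverse, so orthonormality of the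
  columns of \<open>B\<close> already exhibits \<open>B ** transpose B\<close> as the inverse of
  \<open>M\<close>.\<close>

lemma orthonormal_frame:
  fixes M :: "real^'n^'n"
  assumes sym: "transpose M = M" and pos: "\<And>Y. Y \<noteq> 0 \<Longrightarrow> Y \<bullet> (M *v Y) > 0"
  obtains B :: "real^'n^'n" where "transpose B ** M ** B = mat 1" "matrix_inv M = B ** transpose B"
    "invertible B"
proof -
  obtain b :: "'n \<Rightarrow> real^'n"
    where b: "\<forall>i\<in>UNIV. \<forall>j\<in>UNIV. b i \<bullet> (M *v b j) = (if i = j then 1 else 0)"
    using gram_schmidt[OF assms, of UNIV] by blast
  define B where "B = (\<chi> a i. b i $ a)"
  have "B *v axis i 1 = b i" for i
    by (simp add: B_def matrix_vector_mult_basis column_def vec_eq_iff)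
  then have "(transpose B ** M ** B) $ i $ j = b i \<bullet> (M *v b j)" for i j
    by (metis bilin_axis bilin_congruence bilin_def)
  then have 1: "transpose B ** M ** B = mat 1"
    using b by (simp add: vec_eq_iff mat_def)
  then have 2: "B ** (transpose B ** M) = mat 1"
    using matrix_left_right_inverse by blast
  have "transpose (B ** (transpose B ** M)) = M ** (B ** transpose B)"
    by (simp add: matrix_transpose_mul sym matrix_mul_assoc)
  then have "matrix_inv M = B ** transpose B"
    using 2 by (intro matrix_inv_unique) (simp add: transpose_mat)
  moreover have "invertible B" using 2 invertible_right_inverse by blast
  ultimately show ?thesis by (rule that[OF 1])
qed

section \<open>Norm bound for traceless symmetric matrices\<close>

definition outer :: "real^'n \<Rightarrow> real^'n \<Rightarrow> real^'n^'n" where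
  "outer Y Z = (\<chi> i j. Y $ i * Z $ j)"

lemma matrix_inner: "M \<bullet> N = (\<Sum>i\<in>UNIV. \<Sum>j\<in>UNIV. M $ i $ j * N $ i $ j)"
  by (simp add: inner_vec_def)

lemma inner_outer: "M \<bullet> outer Y Z = Y \<bullet> (M *v Z)"
  by (simp add: matrix_inner outer_def inner_vec_def matrix_vector_nth sum_distrib_left mult.left_commute mult.commute)

lemma outer_mult: "outer Y Z *v W = (Z \<bullet> W) *\<^sub>R Y"
  by (simp add: vec_eq_iff outer_def matrix_vector_nth inner_vec_def sum_distrib_left mult.assoc mult.left_commute mult.commute)

lemma inner_mat_1: "M \<bullet> mat 1 = trace M"
  by (simp add: matrix_inner trace_def mat_def if_distrib cong: if_cong)

text \<open>Lower bound for the norm of a traceless symmetric matrix by its projection onto the span of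
  \<open>e\<otimes>Ne + Ne\<otimes>e\<close>, \<open>e\<otimes>e\<close> and the identity.\<close>
lemma traceless_norm_bound_unit:
  fixes N :: "real^'n^'n"
  assumes sym: "transpose N = N" and tr: "trace N = 0" and n: "CARD('n) \<ge> 2" and e: "e \<bullet> e = 1"
  shows "(N *v e) \<bullet> (N *v e) \<le> (real CARD('n) - 1) / real CARD('n) * (N \<bullet> N)"
proof -
  define n' where "n' = real CARD('n)"
  have n': "n' \<ge> 2" using n by (simp add: n'_def)
  define r where "r = N *v e"
  define l where "l = e \<bullet> r"
  \<comment> \<open>\<open>p\<close> and \<open>q\<close> are determined by
    \<open>C *v e = N *v e\<close>, that is \<open>p + q = - l\<close>, and by
    \<open>trace C = 0\<close>. With them \<open>N \<bullet> C = C \<bullet> C\<close>, so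
    \<open>C\<close> is the orthogonal projection of \<open>N\<close>.\<close>
  define p where "p = l / (n' - 1) - l"
  define q where "q = - l / (n' - 1)"
  define C where "C = outer e r + outer r e + p *\<^sub>R outer e e + q *\<^sub>R mat 1"
  have Ne: "e \<bullet> (N *v r) = r \<bullet> r" "r \<bullet> (N *v e) = r \<bullet> r" "e \<bullet> (N *v e) = l"
    using inner_matrix_symmetric[OF sym, of e r] by (auto simp: r_def l_def)
  have NC: "N \<bullet> C = 2 * (r \<bullet> r) + p * l"
    by (simp add: C_def inner_add_right inner_outer inner_mat_1 tr Ne)
  have trace_outer: "trace (outer Y Z) = Y \<bullet> Z" for Y Z :: "real^'n"
    by (simp add: trace_def outer_def inner_vec_def)
  have "C \<bullet> C = (outer e r \<bullet> C + outer r e \<bullet> C) + p * (outer e e \<bullet> C) + q * (mat 1 \<bullet> C)"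
    by (subst C_def) (simp add: inner_add_left)
  also have "outer e r \<bullet> C = r \<bullet> r + l\<^sup>2 + p * l + q * l"
    using e by (simp add: C_def inner_add_right inner_outer inner_mat_1 outer_mult trace_outer l_def
        inner_commute power2_eq_square)
  also have "outer r e \<bullet> C = r \<bullet> r + l\<^sup>2 + p * l + q * l"
    using e by (simp add: C_def inner_add_right inner_outer inner_mat_1 outer_mult trace_outer l_def
        inner_commute power2_eq_square)
  also have "outer e e \<bullet> C = 2 * l + p + q"
    using e by (simp add: C_def inner_add_right inner_outer inner_mat_1 outer_mult trace_outer l_def
        inner_commute)
  also have "mat 1 \<bullet> C = 2 * l + p + q * n'"
    using e by (simp add: C_def inner_add_right inner_outer inner_mat_1 trace_I l_def
        inner_commute n'_def)
  finally have CC: "C \<bullet> C = 2 * (r \<bullet> r + l\<^sup>2 + p * l + q * l) + p * (2 * l + p + q) + q * (2 * l + p + q * n')"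
    by simp
  have "0 \<le> (N - C) \<bullet> (N - C)" by simp
  also have "\<dots> = N \<bullet> N - 2 * (N \<bullet> C) + C \<bullet> C"
    by (simp add: inner_diff_left inner_diff_right inner_commute)
  also have "\<dots> = N \<bullet> N - 2 * (r \<bullet> r) + l\<^sup>2 * (n' - 2) / (n' - 1)"
    unfolding NC CC p_def q_def using n' by (simp add: divide_simps power2_eq_square) algebra
  \<comment> \<open>Cauchy-Schwarz bounds \<open>l\<close> by the length of \<open>r\<close>. This
    yields the sharp constant, since 2 - (n' - 2)/(n' - 1) = n'/(n' - 1).\<close>
  also have "l\<^sup>2 * (n' - 2) / (n' - 1) \<le> (r \<bullet> r) * (n' - 2) / (n' - 1)"
    using Cauchy_Schwarz_ineq[of e r] e n' by (intro divide_right_mono mult_right_mono) (auto simp: l_def)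
  finally have "(r \<bullet> r) * n' \<le> (n' - 1) * (N \<bullet> N)"
    using n' by (simp add: divide_simps split: if_splits) (simp add: algebra_simps)
  then show ?thesis using n' by (simp add: r_def n'_def field_simps)
qed

lemma traceless_norm_bound:
  fixes N :: "real^'n^'n"
  assumes sym: "transpose N = N" and tr: "trace N = 0" and n: "CARD('n) \<ge> 2"
  shows "(N *v e) \<bullet> (N *v e) \<le> (real CARD('n) - 1) / real CARD('n) * (N \<bullet> N) * (e \<bullet> e)"
proof (cases "e = 0")
  case False
  define a where "a = norm e"
  have a: "a > 0" using False by (simp add: a_def)
  define e' where "e' = (1 / a) *\<^sub>R e"
  have "e' \<bullet> e' = 1" using a by (simp add: e'_def dot_square_norm a_def power2_eq_square)
  note bound = traceless_norm_bound_unit[OF sym tr n this]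
  have e: "e = a *\<^sub>R e'" using a by (simp add: e'_def)
  have "(N *v e) \<bullet> (N *v e) = a\<^sup>2 * ((N *v e') \<bullet> (N *v e'))" "e \<bullet> e = a\<^sup>2"
    by (subst e, subst e, simp add: matrix_vector_mult_scaleR power2_eq_square)
      (simp add: dot_square_norm a_def)
  then show ?thesis using mult_left_mono[OF bound, of "a\<^sup>2"] by (simp add: mult_ac)
qed simp

text \<open>The sum in \<open>tensor_norm_sq\<close> at a single point, with the inverse metric and
  the tensor as plain matrices.\<close>

definition tensor_norm :: "real^'n^'n \<Rightarrow> real^'n^'n \<Rightarrow> real" where
  "tensor_norm h K = (\<Sum>i\<in>UNIV. \<Sum>j\<in>UNIV. \<Sum>a\<in>UNIV. \<Sum>b\<in>UNIV. h $ i $ a * h $ j $ b * K $ i $ j * K $ a $ b)"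

lemma tensor_norm_trace:
  assumes "transpose h = h" "transpose K = K"
  shows "tensor_norm h K = trace ((h ** K) ** (h ** K))"
proof -
  have s: "h $ i $ j = h $ j $ i" "K $ i $ j = K $ j $ i" for i j
    using arg_cong[OF assms(1), of "\<lambda>M. M $ j $ i"] arg_cong[OF assms(2), of "\<lambda>M. M $ j $ i"]
    by (simp_all add: transpose_def)
  have "trace ((h ** K) ** (h ** K))
      = (\<Sum>i\<in>UNIV. \<Sum>b\<in>UNIV. \<Sum>j\<in>UNIV. \<Sum>a\<in>UNIV. h $ i $ a * K $ a $ b * (h $ b $ j * K $ j $ i))"
    by (simp add: trace_def matrix_mult_nth sum_distrib_left sum_distrib_right)
  also have "\<dots> = (\<Sum>i\<in>UNIV. \<Sum>j\<in>UNIV. \<Sum>b\<in>UNIV. \<Sum>a\<in>UNIV. h $ i $ a * K $ a $ b * (h $ b $ j * K $ j $ i))"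
    by (rule sum.cong[OF refl], rule sum.swap)
  also have "\<dots> = (\<Sum>i\<in>UNIV. \<Sum>j\<in>UNIV. \<Sum>a\<in>UNIV. \<Sum>b\<in>UNIV. h $ i $ a * K $ a $ b * (h $ b $ j * K $ j $ i))"
    by (rule sum.cong[OF refl], rule sum.cong[OF refl], rule sum.swap)
  also have "\<dots> = tensor_norm h K"
    unfolding tensor_norm_def by (intro sum.cong refl) (simp add: s[of _ _] mult_ac s(1)[of b j for b j] s(2)[of j i for j i])
  finally show ?thesis by simp
qed


lemma trace_scaleR: "trace (a *\<^sub>R M) = a * trace (M :: real^'n^'n)"
  by (simp add: trace_def sum_distrib_left)

lemma matrix_mult_scaleR: "M ** (a *\<^sub>R N) = a *\<^sub>R (M ** (N :: real^'n^'n))" "(a *\<^sub>R M) ** N = a *\<^sub>R (M ** N)"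
  by (simp_all add: vec_eq_iff matrix_mult_nth sum_distrib_left mult.left_commute mult.assoc)

lemma matrix_mult_add: "M ** (N + K) = M ** N + M ** (K :: real^'n^'n)" "(N + K) ** M = N ** M + K ** M"
  by (simp_all add: vec_eq_iff matrix_mult_nth sum.distrib algebra_simps)

lemma matrix_mult_diff: "M ** (N - K) = M ** N - M ** (K :: real^'n^'n)" "(N - K) ** M = N ** M - K ** M"
  by (simp_all add: vec_eq_iff matrix_mult_nth sum_subtractf algebra_simps)

text \<open>Linear algebra of one tangent space, with \<open>M\<close> in the role of the metric at
  a point.\<close>

locale inner_product_matrix =
  fixes M :: "real^'n^'n"
  assumes sym: "transpose M = M" and pos: "\<And>Y. Y \<noteq> 0 \<Longrightarrow> Y \<bullet> (M *v Y) > 0"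
begin

abbreviation h :: "real^'n^'n" where "h \<equiv> matrix_inv M"

definition tr :: "real^'n^'n \<Rightarrow> real" where "tr K = trace (h ** K)"

definition traceless :: "real^'n^'n \<Rightarrow> real^'n^'n" where
  "traceless K = K - (tr K / real CARD('n)) *\<^sub>R M"

lemma inv: "M ** h = mat 1" "h ** M = mat 1"
  using matrix_inv_mult[OF posdef_invertible[OF pos]] by auto

lemma transpose_diff: "transpose (K - a *\<^sub>R N) = transpose K - a *\<^sub>R transpose (N :: real^'n^'n)"
  by (simp add: vec_eq_iff transpose_def)

lemma traceless_transpose: "transpose K = K \<Longrightarrow> transpose (traceless K) = traceless K"
  by (simp add: traceless_def transpose_diff sym)

lemma frame: "\<exists>B :: real^'n^'n. transpose B ** M ** B = mat 1 \<and> h = B ** transpose B \<and> invertible B"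
  by (rule orthonormal_frame[OF sym pos]) blast+

lemma h_transpose: "transpose h = h"
  using transpose_matrix_inv[OF posdef_invertible[OF pos] sym] .

text \<open>Pythagoras: the trace-free part is orthogonal to the multiples of \<open>M\<close>, and
  \<open>M\<close> itself has squared norm \<open>CARD('n)\<close>.\<close>

lemma tensor_norm_traceless:
  assumes "transpose K = K"
  shows "trace ((h ** K) ** (h ** K)) = tensor_norm h (traceless K) + (tr K)\<^sup>2 / real CARD('n)"
proof -
  have hK: "h ** traceless K = h ** K - (tr K / real CARD('n)) *\<^sub>R mat 1"
    by (simp add: traceless_def matrix_mult_diff matrix_mult_scaleR inv)
  define a where "a = tr K / real CARD('n)"
  have "tensor_norm h (traceless K)
      = trace ((h ** K) ** (h ** K)) - a * tr K - (a * tr K - a * (a * of_nat CARD('n)))"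
    unfolding tensor_norm_trace[OF h_transpose traceless_transpose[OF assms]] hK a_def[symmetric]
    by (simp only: matrix_mult_diff matrix_mult_scaleR trace_sub trace_scaleR trace_I tr_def
        matrix_mul_lid matrix_mul_rid right_diff_distrib)
  then show ?thesis by (simp add: a_def power2_eq_square)
qed

text \<open>In an orthonormal frame the tensor norm becomes the sum of squared entries.
  Nonnegativity, definiteness and the Euclidean bound \<open>traceless_norm_bound\<close> thereby
  become available.\<close>

lemma frame_norm:
  assumes B: "h = B ** transpose B" and K: "transpose K = K"
  shows "tensor_norm h K = (transpose B ** K ** B) \<bullet> (transpose B ** K ** B)"
proof -
  define N where "N = transpose B ** K ** B"
  have N: "transpose N = N"
    by (simp add: N_def matrix_transpose_mul K matrix_mul_assoc)
  have "tensor_norm h K = trace (B ** (transpose B ** K ** B ** transpose B ** K))"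
    unfolding tensor_norm_trace[OF h_transpose K] by (simp add: B matrix_mul_assoc)
  also have "\<dots> = trace (N ** N)"
    by (subst trace_mul_sym) (simp add: N_def matrix_mul_assoc)
  also have "\<dots> = N \<bullet> transpose N"
    by (simp add: trace_def matrix_inner matrix_mult_nth transpose_def)
  finally show ?thesis unfolding N unfolding N_def .
qed

lemma tensor_norm_nonneg: "transpose K = K \<Longrightarrow> tensor_norm h K \<ge> 0"
  using frame_norm frame by (metis inner_ge_zero)

lemma tensor_norm_eq_0:
  assumes K: "transpose K = K" and 0: "tensor_norm h K = 0"
  shows "K = 0"
proof -
  obtain B :: "real^'n^'n" where B: "h = B ** transpose B" "invertible B"
    using frame by blast
  have N: "transpose B ** K ** B = 0"
    using frame_norm[OF B(1) K] 0 by simp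
  obtain B' where B': "B ** B' = mat 1" using B(2) invertible_right_inverse by blast
  have "transpose B' ** (transpose B ** K ** B) ** B' = transpose (B ** B') ** K ** (B ** B')"
    by (simp add: matrix_transpose_mul matrix_mul_assoc)
  then show ?thesis
    using N by (simp add: B' transpose_mat matrix_vector_mult_def)
qed

text \<open>\<open>K - r *\<^sub>R M\<close> splits into the trace-free part of \<open>K\<close> and
  a multiple of \<open>M\<close>. The first is controlled by \<open>traceless_norm_bound\<close>,
  the second is explicit, and the weight \<open>q\<close> balances the two;
  \<open>gradient_F_bound\<close> chooses it.\<close>

lemma kato:
  assumes K: "transpose K = K" and n: "CARD('n) \<ge> 2" and q: "q > 0"
  shows "((K - r *\<^sub>R M) *v Y) \<bullet> (h *v ((K - r *\<^sub>R M) *v Y))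
    \<le> ((real CARD('n) - 1) / real CARD('n) + 1 / q)
       * (tensor_norm h (traceless K) + q * (tr K / real CARD('n) - r)\<^sup>2) * (Y \<bullet> (M *v Y))"
proof -
  obtain B :: "real^'n^'n" where B: "transpose B ** M ** B = mat 1" "h = B ** transpose B" "invertible B"
    using frame by blast
  obtain B' where B': "B ** B' = mat 1" using B(3) invertible_right_inverse by blast
  define e where "e = B' *v Y"
  have Y: "Y = B *v e" by (simp add: e_def matrix_vector_mul_assoc B')
  define N where "N = transpose B ** traceless K ** B"
  define t where "t = tr K / real CARD('n) - r"
  have YY: "Y \<bullet> (M *v Y) = e \<bullet> e"
    using bilin_congruence[of B M e e] by (simp add: B(1) Y bilin_def)
  have N: "transpose N = N"
    by (simp add: N_def matrix_transpose_mul traceless_transpose[OF K] matrix_mul_assoc)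
  have "trace N = trace (h ** traceless K)"
    unfolding N_def B(2) by (metis matrix_mul_assoc trace_mul_sym)
  also have "\<dots> = 0"
    by (simp add: traceless_def matrix_mult_diff matrix_mult_scaleR inv trace_sub trace_scaleR trace_I tr_def)
  finally have trN: "trace N = 0" .
  have E: "K - r *\<^sub>R M = traceless K + t *\<^sub>R M"
    by (simp add: traceless_def t_def algebra_simps)
  have BE: "transpose B *v ((K - r *\<^sub>R M) *v Y) = N *v e + t *\<^sub>R e"
  proof -
    have "transpose B *v ((K - r *\<^sub>R M) *v Y) = (transpose B ** (traceless K + t *\<^sub>R M) ** B) *v e"
      unfolding E Y by (simp only: matrix_vector_mul_assoc matrix_mul_assoc)
    also have "transpose B ** (traceless K + t *\<^sub>R M) ** B = N + t *\<^sub>R mat 1"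
      unfolding N_def B(1)[symmetric]
      by (simp add: matrix_mult_add matrix_mult_scaleR)
    finally show ?thesis
      by (simp add: matrix_vector_mult_add_rdistrib scaleR_matrix_vector_assoc[symmetric])
  qed
  have "((K - r *\<^sub>R M) *v Y) \<bullet> (h *v ((K - r *\<^sub>R M) *v Y))
      = (transpose B *v ((K - r *\<^sub>R M) *v Y)) \<bullet> (transpose B *v ((K - r *\<^sub>R M) *v Y))"
    unfolding B(2) by (simp add: matrix_vector_mul_assoc[symmetric] dot_lmul_matrix)
  also have "\<dots> = (norm (N *v e + t *\<^sub>R e))\<^sup>2"
    unfolding BE by (simp add: dot_square_norm)
  also have "\<dots> \<le> (norm (N *v e) + \<bar>t\<bar> * norm e)\<^sup>2"
    using norm_triangle_ineq[of "N *v e" "t *\<^sub>R e"] by (intro power_mono) auto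
  also have "\<dots> \<le> ((real CARD('n) - 1) / real CARD('n) + 1 / q)
       * (N \<bullet> N + q * t\<^sup>2) * (e \<bullet> e)"
  proof -
    define \<alpha> where "\<alpha> = (real CARD('n) - 1) / real CARD('n)"
    have \<alpha>: "\<alpha> > 0" using n by (simp add: \<alpha>_def)
    define x where "x = norm (N *v e)"
    define y where "y = \<bar>t\<bar> * norm e"
    have x: "x\<^sup>2 \<le> \<alpha> * (N \<bullet> N) * (e \<bullet> e)"
      using traceless_norm_bound[OF N trN n, of e] by (simp add: x_def \<alpha>_def dot_square_norm)
    have y: "y\<^sup>2 = t\<^sup>2 * (e \<bullet> e)"
      by (simp add: y_def power_mult_distrib dot_square_norm)
    \<comment> \<open>Weighted Cauchy-Schwarz for \<open>x + y\<close>, with weights \<alpha> and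
      1/q, obtained from the square that is its defect.\<close>
    have "0 \<le> (x - \<alpha> * q * y)\<^sup>2 / (\<alpha> * q)"
      using \<alpha> q by simp
    also have "\<dots> = (\<alpha> + 1 / q) * (x\<^sup>2 / \<alpha> + q * y\<^sup>2) - (x + y)\<^sup>2"
      using \<alpha> q by (simp add: field_simps power2_eq_square)
    finally have "(x + y)\<^sup>2 \<le> (\<alpha> + 1 / q) * (x\<^sup>2 / \<alpha> + q * y\<^sup>2)" by simp
    also have "\<dots> \<le> (\<alpha> + 1 / q) * ((N \<bullet> N) * (e \<bullet> e) + q * (t\<^sup>2 * (e \<bullet> e)))"
      unfolding y using \<alpha> q x by (intro mult_left_mono add_right_mono) (auto simp: field_simps)
    also have "\<dots> = (\<alpha> + 1 / q) * (N \<bullet> N + q * t\<^sup>2) * (e \<bullet> e)"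
      by (simp only: distrib_right mult.assoc)
    finally show ?thesis unfolding x_def y_def \<alpha>_def .
  qed
  also have "N \<bullet> N = tensor_norm h (traceless K)"
    unfolding N_def using frame_norm[OF B(2) traceless_transpose[OF K]] by simp
  finally show ?thesis unfolding YY t_def .
qed

end


section \<open>Change of charts\<close>

context chart_domain
begin

lemma smooth_coordinate:
  assumes "d \<in> A" "S \<subseteq> fst d"
  shows "smooth (\<lambda>y. snd d y $ a)"
proof -
  have "smooth_on (snd c ` (fst c \<inter> fst d)) (\<lambda>y. snd d (chart_inv c y) $ a)"
    using conjunct2[OF conjunct2[OF atlas[unfolded smooth_atlas_def]]] chart assms(1) by auto
  then show ?thesis
    unfolding smooth_def by (rule smooth_on_mono) (use dom assms(2) in auto)
qed

lemma D_coordinate: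
  assumes x: "x \<in> S"
  shows "D i (\<lambda>y. snd c y $ a) x = (if i = a then 1 else 0)"
proof -
  have "D i (\<lambda>y. snd c y $ a) x = partial i (\<lambda>y. y $ a) (snd c x)"
    unfolding coord_deriv_def using x
    by (intro partial_cong[OF open_image]) (auto simp: chart_inv_snd)
  also have "\<dots> = axis i 1 $ a"
    by (rule partial_eq) (rule bounded_linear_imp_has_derivative[OF bounded_linear_vec_nth])
  finally show ?thesis by (simp add: axis_def)
qed

text \<open>The coefficients are \<open>Y\<close> lowered by the metric at \<open>x\<close>, so that
  the gradient there is \<open>Y\<close>. Gradients of smooth functions thus fill the tangent space,
  and \<open>hessian_gradients\<close> determines the Hessian completely.\<close>

definition linear_coordinate :: "'a \<Rightarrow> real^'n \<Rightarrow> 'a \<Rightarrow> real" where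
  "linear_coordinate x Y y = (\<Sum>a\<in>UNIV. (g c x *v Y) $ a * snd c y $ a)"

lemma gradient_linear_coordinate:
  assumes x: "x \<in> S"
  shows "X (linear_coordinate x Y) x = Y"
proof -
  have s: "smooth (\<lambda>y. snd c y $ a)" for a by (rule smooth_coordinate[OF chart dom])
  have "du (linear_coordinate x Y) x = g c x *v Y"
    unfolding linear_coordinate_def[abs_def] using x s
    by (simp add: vec_eq_iff differential_nth D_sum D_cmult smooth_mult smooth_const D_coordinate
        if_distrib[of "\<lambda>t. _ * t"] cong: if_cong)
  then show ?thesis
    using matrix_inv_mult(2)[OF g_invertible[OF x]] by (simp add: gradient_def matrix_vector_mul_assoc)
qed

text \<open>Since the right side only involves gradient products, it yields the tensoriality of the Hessian
  without second derivatives of transition maps.\<close>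
lemma hessian_gradients:
  assumes u: "smooth u" "smooth v" "smooth w" and x: "x \<in> S"
  shows "bilin (H u x) (X v x) (X w x) = (ip v (ip u w) x + ip w (ip u v) x - ip u (ip v w) x) / 2"
proof -
  have *: "ip a (ip b e) x = bilin (H b x) (X a x) (X e x) + bilin (H e x) (X a x) (X b x)"
    if "smooth b" "smooth e" for a b e
    using that x by (simp add: ip_def bilin_def D_ip inner_vec_def differential_nth distrib_left sum.distrib)
  have "bilin (H b x) Y Z = bilin (H b x) Z Y" if "smooth b" for b Y Z
    using inner_matrix_symmetric[OF hessian_transpose[OF that x], of Y Z]
    by (simp add: bilin_def inner_commute)
  with * u show ?thesis by simp
qed

end

section \<open>Transformation laws between two charts\<close>

definition jacobian :: "('a, 'n::finite) chart \<Rightarrow> ('a, 'n) chart \<Rightarrow> 'a \<Rightarrow> real^'n^'n" where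
  "jacobian c d x = (\<chi> a i. coord_deriv c i (\<lambda>y. snd d y $ a) x)"

locale chart_overlap = cc: chart_domain A g c S + dd: chart_domain A g d S
  for A :: "('a::{t2_space, second_countable_topology}, 'n::finite) chart set" and g c d S
begin

abbreviation J :: "'a \<Rightarrow> real^'n^'n" where "J \<equiv> jacobian c d"

lemma coord_deriv_change:
  assumes u: "dd.smooth u" and x: "x \<in> S"
  shows "coord_deriv c i u x = (\<Sum>a\<in>UNIV. coord_deriv d a u x * J x $ a $ i)"
proof -
  define \<tau> where "\<tau> y = snd d (chart_inv c y)" for y
  define y0 where "y0 = snd c x"
  \<comment> \<open>Smoothness of the atlas is stated by components, so the derivative of the
    transition map \<tau> is assembled from them along the axes before the chain rule
    applies.\<close>
  have "(\<lambda>y. \<tau> y $ a) differentiable (at y0)" for a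
    unfolding \<tau>_def y0_def using cc.smooth_differentiable[OF cc.smooth_coordinate[OF dd.chart dd.dom] x] .
  then have "((\<lambda>y. \<Sum>a\<in>UNIV. (\<tau> y $ a) *\<^sub>R axis a 1) has_derivative
      (\<lambda>v. \<Sum>a\<in>UNIV. frechet_derivative (\<lambda>y. \<tau> y $ a) (at y0) v *\<^sub>R axis a (1::real))) (at y0)"
    by (intro has_derivative_sum has_derivative_scaleR_left) (simp add: frechet_derivative_works)
  moreover have "(\<lambda>y. \<Sum>a\<in>UNIV. (\<tau> y $ a) *\<^sub>R axis a 1) = \<tau>"
    by (simp add: fun_eq_iff vec_eq_iff axis_def if_distrib cong: if_cong)
  ultimately have \<tau>: "(\<tau> has_derivative
      (\<lambda>v. \<Sum>a\<in>UNIV. frechet_derivative (\<lambda>y. \<tau> y $ a) (at y0) v *\<^sub>R axis a (1::real))) (at y0)"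
    by simp
  let ?u = "\<lambda>z. u (chart_inv d z)"
  have \<tau>0: "\<tau> y0 = snd d x"
    using x by (simp add: \<tau>_def y0_def cc.chart_inv_snd)
  have du: "?u differentiable (at (\<tau> y0))"
    unfolding \<tau>0 by (rule dd.smooth_differentiable[OF u x])
  have "coord_deriv c i u x = partial i (\<lambda>y. ?u (\<tau> y)) y0"
    unfolding coord_deriv_def y0_def using x
    by (intro partial_cong[OF cc.open_image]) (auto simp: \<tau>_def cc.chart_inv_snd dd.chart_inv_snd)
  also have "\<dots> = frechet_derivative ?u (at (\<tau> y0))
      (\<Sum>a\<in>UNIV. frechet_derivative (\<lambda>y. \<tau> y $ a) (at y0) (axis i 1) *\<^sub>R axis a 1)"
    by (rule partial_eq) (rule has_derivative_compose[OF \<tau> du[unfolded frechet_derivative_works]])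
  also have "\<dots> = (\<Sum>a\<in>UNIV. frechet_derivative (\<lambda>y. \<tau> y $ a) (at y0) (axis i 1)
      * frechet_derivative ?u (at (\<tau> y0)) (axis a 1))"
    using linear_frechet_derivative[OF du] by (simp add: linear_sum linear_cmul)
  also have "\<dots> = (\<Sum>a\<in>UNIV. coord_deriv d a u x * J x $ a $ i)"
    unfolding jacobian_def coord_deriv_def partial_def \<tau>0 by (simp add: \<tau>_def y0_def mult.commute)
  finally show ?thesis .
qed

lemma differential_change:
  assumes "dd.smooth u" "x \<in> S"
  shows "differential c u x = transpose (J x) *v differential d u x"
  unfolding vec_eq_iff matrix_vector_nth
  using assms by (simp add: differential_def coord_deriv_change transpose_def mult.commute)

lemma metric_change:
  assumes x: "x \<in> S"
  shows "g c x = transpose (J x) ** g d x ** J x"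
proof -
  have "g c x $ i $ j = (\<Sum>a\<in>UNIV. \<Sum>b\<in>UNIV. g d x $ a $ b * J x $ a $ i * J x $ b $ j)" for i j
    using conjunct2[OF conjunct2[OF cc.metric[unfolded riemannian_metric_def]], rule_format,
        OF dd.charts_at[OF x] cc.charts_at[OF x]] by (simp add: jacobian_def)
  also have "(\<Sum>a\<in>UNIV. \<Sum>b\<in>UNIV. g d x $ a $ b * J x $ a $ i * J x $ b $ j)
      = (transpose (J x) ** g d x ** J x) $ i $ j" for i j
    by (subst sum.swap) (simp add: matrix_mult_nth transpose_def sum_distrib_left mult_ac)
  finally show ?thesis by (simp add: vec_eq_iff)
qed

text \<open>By \<open>metric_change\<close> a vector in the kernel would have length zero for the
  positive definite metric of \<open>c\<close>.\<close>

lemma jacobian_invertible: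
  assumes x: "x \<in> S"
  shows "invertible (J x)"
  unfolding invertible_left_inverse matrix_left_invertible_ker
proof (intro allI impI)
  fix Y assume "J x *v Y = 0"
  then have "bilin (g c x) Y Y = 0"
    unfolding metric_change[OF x] bilin_congruence by (simp add: bilin_def)
  then show "Y = 0" using cc.g_pos[OF x, of Y] by (auto simp: bilin_def)
qed

lemma inverse_metric_change:
  assumes x: "x \<in> S"
  shows "matrix_inv (g d x) = J x ** matrix_inv (g c x) ** transpose (J x)"
proof -
  note J = matrix_inv_mult[OF jacobian_invertible[OF x]]
  have "transpose (J x) ** g d x ** (J x ** matrix_inv (g c x) ** transpose (J x)) = transpose (J x)"
    using matrix_inv_mult(1)[OF cc.g_invertible[OF x]]
    by (simp add: metric_change[OF x, symmetric] matrix_mul_assoc)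
  then have "transpose (matrix_inv (J x)) ** (transpose (J x) ** g d x ** (J x ** matrix_inv (g c x) ** transpose (J x)))
      = transpose (J x ** matrix_inv (J x))"
    by (simp add: matrix_transpose_mul)
  moreover have "transpose (matrix_inv (J x)) ** transpose (J x) = mat 1"
    using J by (simp add: matrix_transpose_mul[symmetric] transpose_mat)
  ultimately have "g d x ** (J x ** matrix_inv (g c x) ** transpose (J x)) = mat 1"
    using J by (simp add: matrix_mul_assoc transpose_mat)
  then show ?thesis by (rule matrix_inv_unique)
qed

lemma gradient_change:
  assumes "dd.smooth u" "x \<in> S"
  shows "gradient g d u x = J x *v gradient g c u x"
  unfolding gradient_def differential_change[OF assms] inverse_metric_change[OF assms(2)]
  by (simp only: matrix_vector_mul_assoc matrix_mul_assoc)

lemma ip_change: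
  assumes "dd.smooth u" "dd.smooth v" "x \<in> S"
  shows "cc.ip u v x = dd.ip u v x"
  unfolding cc.ip_def dd.ip_def differential_change[OF assms(2,3)] gradient_change[OF assms(1,3)]
  using dot_lmul_matrix[of "differential d v x" "J x" "gradient g c u x"]
  by (simp add: inner_commute)

text \<open>The outer product differentiates the inner one, so the inner products have to agree on
  the whole open set \<open>S\<close>, not just at \<open>x\<close>.\<close>

lemma iterated_ip_change:
  assumes u: "cc.smooth u" "dd.smooth u" "cc.smooth v" "dd.smooth v" "dd.smooth w" and x: "x \<in> S"
  shows "cc.ip w (cc.ip u v) x = dd.ip w (dd.ip u v) x"
proof -
  have eq: "cc.ip u v y = dd.ip u v y" if "y \<in> S" for y
    using u(2,4) that by (rule ip_change)
  have "cc.ip w (cc.ip u v) x = cc.ip w (dd.ip u v) x"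
    using cc.D_cong[OF x, of "cc.ip u v" "dd.ip u v"] eq by (simp add: cc.ip_sum[of w])
  also have "\<dots> = dd.ip w (dd.ip u v) x"
    using u x by (intro ip_change dd.smooth_ip)
  finally show ?thesis .
qed

lemma hessian_change:
  assumes u: "cc.smooth u" "dd.smooth u" and x: "x \<in> S"
  shows "hessian g c u x = transpose (J x) ** hessian g d u x ** J x"
proof (rule bilin_eqI)
  fix Y Z :: "real^'n"
  \<comment> \<open>Arbitrary vectors \<open>Y\<close> and \<open>Z\<close> are realised as
    gradients at \<open>x\<close>, so that both Hessians can be read off from iterated gradient
    products.\<close>
  define v where "v = cc.linear_coordinate x Y"
  define w where "w = cc.linear_coordinate x Z"
  have s: "cc.smooth (cc.linear_coordinate x Y)" "dd.smooth (cc.linear_coordinate x Y)" for Y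
    unfolding cc.linear_coordinate_def[abs_def]
    by (intro cc.smooth_sum cc.smooth_mult cc.smooth_const cc.smooth_coordinate[OF cc.chart cc.dom]
        dd.smooth_sum dd.smooth_mult dd.smooth_const dd.smooth_coordinate[OF cc.chart cc.dom])+
  have v: "cc.smooth v" "dd.smooth v" "cc.smooth w" "dd.smooth w"
    unfolding v_def w_def by (rule s)+
  have Y: "gradient g c v x = Y" "gradient g c w x = Z"
    unfolding v_def w_def by (rule cc.gradient_linear_coordinate[OF x])+
  have "bilin (hessian g c u x) Y Z = bilin (hessian g d u x) (gradient g d v x) (gradient g d w x)"
    using cc.hessian_gradients[OF u(1) v(1,3) x] dd.hessian_gradients[OF u(2) v(2,4) x]
    by (simp add: Y iterated_ip_change u v x)
  then show "bilin (hessian g c u x) Y Z = bilin (transpose (J x) ** hessian g d u x ** J x) Y Z"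
    using v x by (simp add: bilin_congruence gradient_change Y)
qed

lemma laplacian_change:
  assumes u: "cc.smooth u" "dd.smooth u" and x: "x \<in> S"
  shows "cc.L u x = dd.L u x"
proof -
  have "cc.L u x = trace ((matrix_inv (g c x) ** (transpose (J x) ** hessian g d u x)) ** J x)"
    by (simp add: cc.L_trace[OF u(1) x] hessian_change[OF u x] matrix_mul_assoc)
  also have "\<dots> = trace (J x ** (matrix_inv (g c x) ** (transpose (J x) ** hessian g d u x)))"
    by (rule trace_mul_sym)
  also have "\<dots> = dd.L u x"
    by (simp add: dd.L_trace[OF u(2) x] inverse_metric_change[OF x] matrix_mul_assoc)
  finally show ?thesis .
qed

end

section \<open>The drift Laplacian of powers of \<open>F\<close>\<close>

context chart_domain
begin

lemma inner_product_matrix: "x \<in> S \<Longrightarrow> inner_product_matrix (g c x)"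
  by unfold_locales (simp_all add: g_transpose g_pos)

lemma ip_const: "ip (\<lambda>y. a) u x = 0" "ip u (\<lambda>y. a) x = 0"
  by (simp_all add: ip_sum gradient_nth D_const)

lemma L_const: "L (\<lambda>y. a) x = 0"
  by (simp add: L_def divergence_def gradient_nth D_const)

lemma ip_square:
  assumes s: "smooth s" and x: "x \<in> S"
  shows "ip (\<lambda>y. (s y)\<^sup>2) (\<lambda>y. (s y)\<^sup>2) x = 4 * (s x)\<^sup>2 * ip s s x"
  using assms by (simp add: power2_eq_square ip_mult smooth_mult ip_sym[of x "\<lambda>y. s y * s y"])

text \<open>Chain rule for a power of \<open>G\<close> with exponent a = 2/(2 - m). The relations a
  (m - 2) = -2 and 2 (a - 1) = m a turn the potential term and the squared gradient of
  \<open>G\<close> into the two terms on the right.\<close>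

lemma green_power:
  assumes G: "smooth G" and f: "smooth f" and pos: "\<And>y. y \<in> S \<Longrightarrow> G y > 0" and x: "x \<in> S"
    and w: "\<And>y. y \<in> S \<Longrightarrow> w y = 1/4 * G y powr (2 / (2 - m))" and m: "m > 2"
    and eq: "L G x - ip f G x = m * (m - 2) * k / 4 * G x"
  shows "w x * (L w x - ip f w x) = m / 2 * ip w w x - m / 2 * k * (w x * w x)"
proof -
  define a where "a = 2 / (2 - m)"
  have a: "a * (m - 2) = - 2" "(a - 1) * 2 = m * a" using m by (simp_all add: a_def field_simps)
  have sG: "smooth (\<lambda>y. G y powr a)" using G pos by (rule smooth_powr)
  have sw: "smooth (\<lambda>y. 1/4 * G y powr a)" by (intro smooth_mult smooth_const sG)
  have wa: "w y = 1/4 * G y powr a" if "y \<in> S" for y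
    using w[OF that] by (simp add: a_def)
  have D: "D i w x = D i (\<lambda>y. 1/4 * G y powr a) x" for i
    using x wa by (rule D_cong)
  define P where "P = ip G G x"
  \<comment> \<open>Every power of \<open>G\<close> that occurs is \<open>t\<close> times 1,
    \<open>G x\<close> or its square, so only polynomial algebra remains.\<close>
  define t where "t = G x powr (a - 2)"
  have t1: "G x powr (a - 1) = t * G x" and t2: "G x powr a = t * (G x)\<^sup>2"
    using pos[OF x] by (simp_all add: t_def powr_diff power2_eq_square)
  have L_powr': "L (\<lambda>y. G y powr a) x = a * G x powr (a - 1) * L G x + a * (a - 1) * G x powr (a - 2) * ip G G x"
    using G pos x by (rule L_powr)
  have "L w x = L (\<lambda>y. 1/4 * G y powr a) x"
    using x wa by (rule L_cong)
  also have "\<dots> = 1/4 * (a * (t * G x) * L G x + a * (a - 1) * t * P)"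
    unfolding L_cmult[OF sG x] L_powr' t1 P_def t_def by simp
  finally have Lw: "L w x = 1/4 * (a * (t * G x) * L G x + a * (a - 1) * t * P)" .
  have ipw: "ip v w x = 1/4 * (a * (t * G x)) * ip v G x" for v
  proof -
    have "ip v w x = ip v (\<lambda>y. 1/4 * G y powr a) x" by (simp add: ip_sum D)
    also have "\<dots> = 1/4 * ((a * G x powr (a - 1)) * ip v G x)"
      unfolding ip_cmult[OF sG x] ip_powr[OF G x pos[OF x]] ..
    finally show ?thesis by (simp add: t1)
  qed
  have "ip w w x = 1/4 * (a * (t * G x)) * ip w G x" by (rule ipw)
  also have "ip w G x = ip G w x" using x by (rule ip_sym)
  also have "\<dots> = 1/4 * (a * (t * G x)) * P" unfolding P_def by (rule ipw)
  finally have ww: "ip w w x = (1/4 * (a * (t * G x)))\<^sup>2 * P" by (simp add: power2_eq_square)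
  have "L w x - ip f w x = 1/4 * (a * (t * G x) * (L G x - ip f G x) + a * (a - 1) * t * P)"
    by (simp add: Lw ipw algebra_simps)
  also have "a * (t * G x) * (L G x - ip f G x) = (a * (m - 2)) * (t * m * k / 4 * (G x)\<^sup>2)"
    unfolding eq by (simp add: power2_eq_square)
  also have "a * (a - 1) * t * P = a * ((a - 1) * 2) * t * P / 2"
    by simp
  finally have diff: "L w x - ip f w x = 1/8 * t * (m * a\<^sup>2 * P - m * k * (G x)\<^sup>2)"
    unfolding a by (simp add: power2_eq_square algebra_simps)
  show ?thesis
    unfolding diff ww wa[OF x] t2 by (simp add: power2_eq_square algebra_simps)
qed

text \<open>The first quantity in the theorem, with \<open>w\<close> in place of \<open>s\<^sup>2\<close>.\<close>
definition rigidity_defect :: "('a \<Rightarrow> real) \<Rightarrow> real \<Rightarrow> real \<Rightarrow> ('a \<Rightarrow> real) \<Rightarrow> 'a \<Rightarrow> real" where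
  "rigidity_defect f m k w x = tensor_norm (h x) (inner_product_matrix.traceless (g c x) (H w x))
     + real CARD('n) / (m * (m - real CARD('n)))
        * ((m - real CARD('n)) / real CARD('n) * L w x + ip f w x)\<^sup>2
     + bilin (curvature_excess g f m k c x) (X w x) (X w x)"

lemma bilin_curvature_excess:
  assumes x: "x \<in> S"
  shows "bilin (curvature_excess g f m k c x) (X w x) (X w x)
    = bilin (ricci g c x) (X w x) (X w x) + bilin (H f x) (X w x) (X w x)
      - (ip f w x)\<^sup>2 / (m - real CARD('n)) - (m - 1) * k * ip w w x"
proof -
  have "(\<chi> i j. D i f x * D j f x / (m - real CARD('n))) = (1 / (m - real CARD('n))) *\<^sub>R outer (du f x) (du f x)"
    by (simp add: outer_def vec_eq_iff differential_nth)
  moreover have "X w x \<bullet> (g c x *v X w x) = ip w w x"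
    by (simp add: metric_gradient[OF x] ip_def)
  moreover have "X w x \<bullet> du f x = ip f w x"
    using ip_sym[OF x, of f w] by (simp add: ip_def)
  ultimately show ?thesis
    by (simp add: curvature_excess_def bakry_emery_ricci_def bilin_def matrix_vector_mult_diff_rdistrib
        matrix_vector_mult_add_rdistrib inner_diff_right inner_add_right outer_mult
        scaleR_matrix_vector_assoc[symmetric] power2_eq_square inner_commute[of "du f x"])
qed

text \<open>The Green function has been eliminated: what follows sees it only through the two
  relations \<open>F_eq\<close> and \<open>L_w\<close> between \<open>w\<close> and
  \<open>F\<close>.\<close>

context
  fixes f w F :: "'a \<Rightarrow> real" and m k :: real
  assumes f: "smooth f" and w: "smooth w" and F: "smooth F"
    and w_pos: "\<And>y. y \<in> S \<Longrightarrow> w y > 0"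
    and F_eq: "\<And>y. y \<in> S \<Longrightarrow> w y * F y = ip w w y + k * (w y * w y)"
    and L_w: "\<And>y. y \<in> S \<Longrightarrow> L w y = m * (F y / 2 - k * w y) + ip f w y"
    and m: "m > real CARD('n)"
begin

text \<open>This is \<open>F_eq\<close> differentiated. By \<open>L_w\<close> the subtracted
  coefficient \<open>F x / 2 - k * w x\<close> equals \<open>(L w x - ip f w x) / m\<close>.\<close>

lemma differential_F:
  assumes x: "x \<in> S"
  shows "w x *\<^sub>R du F x = 2 *\<^sub>R ((H w x - (F x / 2 - k * w x) *\<^sub>R g c x) *v X w x)"
proof -
  have "w x * D i F x = 2 * (H w x *v X w x) $ i - 2 * (F x / 2 - k * w x) * D i w x" for i
  proof -
    have "D i (\<lambda>y. w y * F y) x = D i (\<lambda>y. ip w w y + k * (w y * w y)) x"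
      using x F_eq by (rule D_cong)
    then show ?thesis
      using x w F by (simp add: D_mult D_add D_const D_ip smooth_mult smooth_ip smooth_const algebra_simps)
  qed
  then show ?thesis
    by (simp add: vec_eq_iff differential_nth matrix_vector_mult_diff_rdistrib
        scaleR_matrix_vector_assoc[symmetric] metric_gradient[OF x] right_diff_distrib)
qed

text \<open>Both operators are applied to \<open>F_eq\<close>. The coefficient \<open>2 - m\<close>
  arises as 2 from the product rule for \<open>w F\<close>, minus \<open>m\<close> from the gradient
  of \<open>L w\<close>, which \<open>L_w\<close> expresses through \<open>F\<close>. The terms
  \<open>Hw\<close> cancel between the Bochner formula and the drift, leaving \<open>Hf\<close> for
  the weighted Ricci tensor.\<close>

lemma drift_F:
  assumes x: "x \<in> S"
  shows "w x * (L F x - ip f F x) + (2 - m) * ip w F x = 2 * rigidity_defect f m k w x"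
proof -
  interpret M: inner_product_matrix "g c x" by (rule inner_product_matrix[OF x])
  define N where "N = real CARD('n)"
  have N: "N > 0" "m > N" using m by (simp_all add: N_def)
  define a \<phi> P W where "a = L w x" and "\<phi> = ip f w x" and "P = ip w w x" and "W = w x"
  define tn where "tn = tensor_norm (h x) (M.traceless (H w x))"
  define R where "R = bilin (ricci g c x) (X w x) (X w x)"
  define Hf where "Hf = bilin (H f x) (X w x) (X w x)"
  define Hw where "Hw = X w x \<bullet> (H w x *v X f x)"
  have 1: "W * L F x + F x * a + 2 * ip w F x = L (ip w w) x + k * (2 * W * a + 2 * P)"
  proof -
    have "L (\<lambda>y. w y * F y) x = L (\<lambda>y. ip w w y + k * (w y * w y)) x"
      using x F_eq by (rule L_cong)
    then show ?thesis
      using x w F by (simp add: L_mult L_add L_const ip_const smooth_mult smooth_ip smooth_const a_def P_def W_def)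
  qed
  have 2: "W * ip f F x + F x * \<phi> = ip f (ip w w) x + k * 2 * W * \<phi>"
  proof -
    have "D i (\<lambda>y. w y * F y) x = D i (\<lambda>y. ip w w y + k * (w y * w y)) x" for i
      using x F_eq by (rule D_cong)
    then have "ip f (\<lambda>y. w y * F y) x = ip f (\<lambda>y. ip w w y + k * (w y * w y)) x"
      unfolding ip_sum[of f] by simp
    then show ?thesis
      using x w F by (simp add: ip_mult ip_add ip_const smooth_mult smooth_ip smooth_const \<phi>_def W_def)
  qed
  have "trace ((h x ** H w x) ** (h x ** H w x)) = tn + a\<^sup>2 / N"
    using M.tensor_norm_traceless[OF hessian_transpose[OF w x]]
    by (simp add: tn_def a_def N_def M.tr_def L_trace[OF w x])
  then have 3: "L (ip w w) x = 2 * (tn + a\<^sup>2 / N + ip w (L w) x + R)"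
    using bochner[OF w x] by (simp add: trace_def matrix_mult_nth R_def)
  have 4: "ip w (L w) x = m * (ip w F x / 2 - k * P) + (Hf + Hw)"
  proof -
    \<comment> \<open>Naming the constant keeps \<open>F y / 2\<close> in the form of a left
      multiple, the shape \<open>ip_cmult\<close> expects.\<close>
    define b :: real where b: "b = 1/2"
    have "D i (L w) x = D i (\<lambda>y. m * (b * F y - k * w y) + ip f w y) x" for i
      using x L_w by (intro D_cong) (simp_all add: b)
    then have "ip w (L w) x = ip w (\<lambda>y. m * (b * F y - k * w y) + ip f w y) x"
      unfolding ip_sum[of w] by simp
    also have "\<dots> = m * (b * ip w F x - k * P) + ip w (ip f w) x"
      using x w F f by (simp add: ip_add ip_cmult ip_diff smooth_mult smooth_diff smooth_ip smooth_const P_def)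
    also have "ip w (ip f w) x = Hf + Hw"
      using x w f by (simp add: ip_def[of w] inner_vec_def[of "X w x"] differential_nth D_ip distrib_left
          sum.distrib Hf_def Hw_def bilin_def)
    finally show ?thesis by (simp add: b)
  qed
  have 5: "ip f (ip w w) x = 2 * Hw"
  proof -
    have "ip f (ip w w) x = 2 * (X f x \<bullet> (H w x *v X w x))"
      using x w by (simp add: ip_def[of f] inner_vec_def[of "X f x"] differential_nth D_ip
          sum_distrib_left mult.left_commute)
    also have "X f x \<bullet> (H w x *v X w x) = Hw"
      using inner_matrix_symmetric[OF hessian_transpose[OF w x], of "X f x" "X w x"]
      by (simp add: Hw_def inner_commute)
    finally show ?thesis .
  qed
  have 6: "F x - 2 * k * W = 2 * (a - \<phi>) / m"
    using L_w[OF x] N by (simp add: a_def \<phi>_def W_def field_simps)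
  have 7: "bilin (curvature_excess g f m k c x) (X w x) (X w x) = R + Hf - \<phi>\<^sup>2 / (m - N) - (m - 1) * k * P"
    unfolding R_def Hf_def \<phi>_def P_def N_def by (rule bilin_curvature_excess[OF x])
  \<comment> \<open>Origin of D_m: completing the square in the trace terms. The remainder
    \<open>\<phi>\<^sup>2 / (m - N)\<close> is the one contained in the curvature term
    \<open>7\<close>.\<close>
  have 8: "a\<^sup>2 / N - (a - \<phi>)\<^sup>2 / m = N / (m * (m - N)) * ((m - N) / N * a + \<phi>)\<^sup>2 - \<phi>\<^sup>2 / (m - N)"
  proof -
    have "m - N \<noteq> 0" "m \<noteq> 0" "N \<noteq> 0" using N by auto
    then show ?thesis by (simp add: divide_simps power2_eq_square) (simp add: algebra_simps)
  qed
  have "W * (L F x - ip f F x) + (2 - m) * ip w F x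
      = 2 * tn + 2 * a\<^sup>2 / N + 2 * (R + Hf - (m - 1) * k * P) - (F x - 2 * k * W) * (a - \<phi>)"
    using 1 2 unfolding 3 4 5 by (simp add: algebra_simps)
  also have "(F x - 2 * k * W) * (a - \<phi>) = 2 * ((a - \<phi>)\<^sup>2 / m)"
    unfolding 6 by (simp add: power2_eq_square)
  also have "2 * tn + 2 * a\<^sup>2 / N + 2 * (R + Hf - (m - 1) * k * P) - 2 * ((a - \<phi>)\<^sup>2 / m)
      = 2 * (tn + (a\<^sup>2 / N - (a - \<phi>)\<^sup>2 / m) + (R + Hf - (m - 1) * k * P))"
    by simp
  also have "\<dots> = 2 * rigidity_defect f m k w x"
    unfolding 8 rigidity_defect_def 7 tn_def[symmetric] N_def[symmetric] a_def[symmetric] \<phi>_def[symmetric] by simp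
  finally show ?thesis by (simp only: W_def)
qed


lemma ip_self_nonneg:
  assumes x: "x \<in> S"
  shows "ip u u x \<ge> 0"
proof -
  have "ip u u x = X u x \<bullet> (g c x *v X u x)"
    by (simp add: ip_def metric_gradient[OF x])
  then show ?thesis
    using g_pos[OF x, of "X u x"] by (cases "X u x = 0") auto
qed

lemma F_pos:
  assumes "x \<in> S" "k > 0"
  shows "F x > 0"
proof -
  have "w x * F x > 0"
    using F_eq[OF assms(1)] ip_self_nonneg[OF assms(1), of w] w_pos[OF assms(1)] assms(2)
    by (simp add: add_nonneg_pos)
  then show ?thesis using w_pos[OF assms(1)] by (simp add: zero_less_mult_iff)
qed

text \<open>For nonzero \<gamma> the factor in front does not vanish, so the differential equation
  for the power becomes an algebraic relation between the defect and the squared gradient of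
  \<open>F\<close>.\<close>

lemma drift_F_powr:
  assumes x: "x \<in> S" and k: "k > 0"
  shows "L (\<lambda>y. F y powr \<gamma>) x - ip f (\<lambda>y. F y powr \<gamma>) x + (2 - m) / w x * ip w (\<lambda>y. F y powr \<gamma>) x
    = \<gamma> * F x powr (\<gamma> - 2) * (2 * F x * rigidity_defect f m k w x / w x + (\<gamma> - 1) * ip F F x)"
proof -
  have LF: "L (\<lambda>y. F y powr \<gamma>) x = \<gamma> * F x powr (\<gamma> - 1) * L F x + \<gamma> * (\<gamma> - 1) * F x powr (\<gamma> - 2) * ip F F x"
    using F F_pos[OF _ k] x by (rule L_powr)
  have p: "F x powr (\<gamma> - 1) = F x powr (\<gamma> - 2) * F x"
    using F_pos[OF x k] by (simp add: powr_diff power2_eq_square)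
  have "L F x - ip f F x + (2 - m) / w x * ip w F x = 2 * rigidity_defect f m k w x / w x"
    using drift_F[OF x] w_pos[OF x] by (simp add: field_simps)
  then have e: "2 * F x * rigidity_defect f m k w x / w x = F x * (L F x - ip f F x + (2 - m) / w x * ip w F x)"
    by simp
  show ?thesis
    unfolding e LF ip_powr[OF F x F_pos[OF x k]] p by (simp add: algebra_simps)
qed

lemma gradient_F_bound:
  assumes x: "x \<in> S" and n: "CARD('n) \<ge> 2" and k: "k > 0"
    and exc: "bilin (curvature_excess g f m k c x) (X w x) (X w x) \<ge> 0"
  shows "(w x)\<^sup>2 * ip F F x \<le> 4 * ((m - 1) / m) * rigidity_defect f m k w x * ip w w x"
proof -
  interpret M: inner_product_matrix "g c x" by (rule inner_product_matrix[OF x])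
  define N where "N = real CARD('n)"
  have N: "N > 0" "m > N" using m by (simp_all add: N_def)
  define Z where "Z = (H w x - (F x / 2 - k * w x) *\<^sub>R g c x) *v X w x"
  \<comment> \<open>The weight with 1/q = 1/N - 1/m. It turns the Kato constant (N - 1)/N + 1/q into
    (m - 1)/m and, at the same time, the squared trace term into D_m.\<close>
  define q where "q = N * m / (m - N)"
  have q: "q > 0" using N by (simp add: q_def)
  have "(w x)\<^sup>2 * ip F F x = (h x *v (w x *\<^sub>R du F x)) \<bullet> (w x *\<^sub>R du F x)"
    by (simp add: ip_def gradient_def matrix_vector_mult_scaleR power2_eq_square)
  also have "\<dots> = 4 * (Z \<bullet> (h x *v Z))"
    unfolding differential_F[OF x] Z_def[symmetric] by (simp add: matrix_vector_mult_scaleR inner_commute)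
  also have "Z \<bullet> (h x *v Z) \<le> ((N - 1) / N + 1 / q) * (tensor_norm (h x) (M.traceless (H w x))
      + q * (M.tr (H w x) / N - (F x / 2 - k * w x))\<^sup>2) * (X w x \<bullet> (g c x *v X w x))"
    unfolding Z_def N_def by (rule M.kato[OF hessian_transpose[OF w x] n q])
  also have "X w x \<bullet> (g c x *v X w x) = ip w w x"
    by (simp add: ip_def metric_gradient[OF x])
  also have "(N - 1) / N + 1 / q = (m - 1) / m"
    using N by (simp add: q_def field_simps)
  also have "q * (M.tr (H w x) / N - (F x / 2 - k * w x))\<^sup>2
      = N / (m * (m - N)) * ((m - N) / N * L w x + ip f w x)\<^sup>2"
  proof -
    have r: "F x / 2 - k * w x = (L w x - ip f w x) / m"
      using L_w[OF x] N by simp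
    have tr: "M.tr (H w x) = L w x" by (simp add: M.tr_def L_trace[OF w x])
    have "M.tr (H w x) / N - (F x / 2 - k * w x) = ((m - N) / N * L w x + ip f w x) / m"
      unfolding r tr using N by (simp add: field_simps)
    then show ?thesis using N by (simp add: q_def power_divide power2_eq_square)
  qed
  finally have "(w x)\<^sup>2 * ip F F x \<le> 4 * ((m - 1) / m * (tensor_norm (h x) (M.traceless (H w x))
      + N / (m * (m - N)) * ((m - N) / N * L w x + ip f w x)\<^sup>2) * ip w w x)"
    by simp
  \<comment> \<open>The curvature summand is nonnegative, so adding it completes the defect without
    breaking the inequality.\<close>
  also have "\<dots> \<le> 4 * ((m - 1) / m * rigidity_defect f m k w x * ip w w x)"
    using exc N n ip_self_nonneg[OF x, of w]
    by (intro mult_left_mono mult_right_mono) (simp_all add: rigidity_defect_def N_def)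
  finally show ?thesis by (simp only: mult.assoc)
qed

lemma drift_F_powr_eq_0_iff:
  assumes x: "x \<in> S" and n: "CARD('n) \<ge> 2" and k: "k > 0"
    and exc: "bilin (curvature_excess g f m k c x) (X w x) (X w x) \<ge> 0"
    and Q: "rigidity_defect f m k w x \<ge> 0" and \<gamma>: "2 * \<gamma> \<ge> (m - 2) / (m - 1)"
  shows "L (\<lambda>y. F y powr \<gamma>) x - ip f (\<lambda>y. F y powr \<gamma>) x + (2 - m) / w x * ip w (\<lambda>y. F y powr \<gamma>) x = 0
    \<longleftrightarrow> rigidity_defect f m k w x = 0"
proof -
  have m2: "m > 2" using m n by simp
  then have "(m - 2) / (m - 1) > 0" by simp
  \<comment> \<open>Positivity of \<gamma> allows cancelling the factor in front of the bracket in
    \<open>drift_F_powr\<close>.\<close>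
  then have "\<gamma> > 0" using \<gamma> by linarith
  define W P q I where "W = w x" and "P = ip w w x" and "q = rigidity_defect f m k w x" and "I = ip F F x"
  have pos: "W > 0" "F x > 0" "I \<ge> 0" "q \<ge> 0" "P \<ge> 0"
    using w_pos[OF x] F_pos[OF x k] ip_self_nonneg[OF x] Q by (simp_all add: W_def I_def q_def P_def)
  have bound: "W\<^sup>2 * I \<le> 4 * ((m - 1) / m) * q * P"
    using gradient_F_bound[OF x n k exc] by (simp add: W_def I_def q_def P_def)
  have "(2 * F x * q / W + (\<gamma> - 1) * I = 0) \<longleftrightarrow> q = 0"
  proof
    assume "q = 0"
    then have "W\<^sup>2 * I \<le> 0" using bound by simp
    then have "I = 0" using pos by (simp add: mult_le_0_iff)
    then show "2 * F x * q / W + (\<gamma> - 1) * I = 0" using \<open>q = 0\<close> by simp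
  next
    assume 0: "2 * F x * q / W + (\<gamma> - 1) * I = 0"
    \<comment> \<open>This is where the range of \<beta> = 2 \<gamma> enters: the bound times the
      constant 4 (m - 1)/m of \<open>gradient_F_bound\<close> is exactly 2.\<close>
    have "1 - \<gamma> \<le> m / (2 * (m - 1))"
      using \<gamma> m2 by (simp add: field_simps)
    then have "(1 - \<gamma>) * (W\<^sup>2 * I) \<le> m / (2 * (m - 1)) * (W\<^sup>2 * I)"
      using pos by (intro mult_right_mono) auto
    also have "\<dots> \<le> m / (2 * (m - 1)) * (4 * ((m - 1) / m) * q * P)"
      using bound m2 by (intro mult_left_mono) auto
    also have "\<dots> = 2 * q * P"
      using m2 by (simp add: field_simps)
    also have "P = W * F x - k * W\<^sup>2"
      using F_eq[OF x] by (simp add: P_def W_def power2_eq_square)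
    finally have le: "(1 - \<gamma>) * (W\<^sup>2 * I) \<le> 2 * q * (W * F x - k * W\<^sup>2)" .
    have "(1 - \<gamma>) * I = 2 * F x * q / W"
      using 0 by (simp add: algebra_simps)
    then have "(1 - \<gamma>) * (W\<^sup>2 * I) = W\<^sup>2 * (2 * F x * q / W)"
      by (metis mult.left_commute)
    also have "\<dots> = 2 * q * (W * F x)" using pos by (simp add: power2_eq_square)
    \<comment> \<open>The main terms agree on both sides; only \<open>k * W\<^sup>2\<close>, the gap
      between \<open>P\<close> and \<open>W * F x\<close>, remains to force
      \<open>q = 0\<close>.\<close>
    finally have "2 * q * (W * F x) \<le> 2 * q * (W * F x - k * W\<^sup>2)" using le by simp
    then have "q * (k * W\<^sup>2) \<le> 0" by (simp add: algebra_simps)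
    then show "q = 0" using pos k by (simp add: mult_le_0_iff zero_less_mult_iff)
  qed
  then show ?thesis
    unfolding drift_F_powr[OF x k] q_def W_def I_def using \<open>\<gamma> > 0\<close> pos by simp
qed

end

end

section \<open>Scalar invariants on the manifold\<close>

locale riemannian_atlas =
  fixes A :: "('a::{t2_space, second_countable_topology}, 'n::finite) chart set"
    and g :: "('a, 'n) tensor2"
  assumes atlas: "smooth_atlas A" and metric: "riemannian_metric A g"
begin

lemma chart_domain: "c \<in> A \<Longrightarrow> open S \<Longrightarrow> S \<subseteq> fst c \<Longrightarrow> chart_domain A g c S"
  by unfold_locales (simp_all add: atlas metric)

lemma open_chart: "c \<in> A \<Longrightarrow> open (fst c)"
  using conjunct1[OF atlas[unfolded smooth_atlas_def]] by simp

lemma chart_at: "chart_at A x \<in> charts_at A x"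
proof -
  have "(\<Union>c\<in>A. fst c) = UNIV"
    using conjunct1[OF conjunct2[OF atlas[unfolded smooth_atlas_def]]] .
  then have "x \<in> (\<Union>c\<in>A. fst c)" by simp
  then obtain c where "c \<in> charts_at A x" by (auto simp: charts_at_def)
  then show ?thesis unfolding chart_at_def by (rule someI)
qed

lemma smooth_funD:
  assumes "smooth_fun_on A W u" "chart_domain A g c S" "S \<subseteq> W"
  shows "chart_domain.smooth c S u"
proof -
  interpret chart_domain A g c S by fact
  have "smooth_on (snd c ` (fst c \<inter> W)) (\<lambda>y. u (chart_inv c y))"
    using assms(1) chart unfolding smooth_fun_on_def by simp
  then show ?thesis
    unfolding smooth_def by (rule smooth_on_mono) (use assms(3) dom in auto)
qed

lemma smooth_funI:
  assumes "open W" "\<And>c. c \<in> A \<Longrightarrow> chart_domain A g c (fst c \<inter> W) \<Longrightarrow> chart_domain.smooth c (fst c \<inter> W) u"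
  shows "smooth_fun_on A W u"
  unfolding smooth_fun_on_def
proof
  fix c assume c: "c \<in> A"
  interpret chart_domain A g c "fst c \<inter> W"
    using assms(1) c by (intro chart_domain open_Int open_chart) auto
  show "smooth_on (snd c ` (fst c \<inter> W)) (\<lambda>y. u (chart_inv c y))"
    using assms(2)[OF c chart_domain_axioms] unfolding smooth_def .
qed

lemma overlap_at:
  assumes "open W" "x \<in> W" "c \<in> charts_at A x" "d \<in> charts_at A x"
  obtains S where "chart_overlap A g c d S" "x \<in> S" "S \<subseteq> W"
proof
  show "chart_overlap A g c d (fst c \<inter> fst d \<inter> W)"
    unfolding chart_overlap_def using assms
    by (auto intro!: chart_domain open_Int open_chart simp: charts_at_def)
  show "x \<in> fst c \<inter> fst d \<inter> W" using assms by (auto simp: charts_at_def)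
qed auto

text \<open>Valid for arbitrary functions, because the chart is the one inside the definition. In
  this form it also applies to powers of \<open>v\<close>.\<close>

lemma grad_inner_at:
  assumes "chart_domain A g c S" "x \<in> S" "c = chart_at A x"
  shows "grad_inner A g u v x = chart_domain.ip g c u v x"
proof -
  interpret chart_domain A g c S by fact
  show ?thesis
    using metric_gradient[OF assms(2), of v]
    by (simp add: grad_inner_def Let_def assms(3)[symmetric] bilin_def ip_def)
qed

text \<open>In contrast to \<open>grad_inner_at\<close>, the chart may stay fixed while the point
  moves. This makes \<open>grad_inner\<close> a function that can be differentiated in
  coordinates.\<close>

lemma grad_inner_chart:
  assumes W: "open W" "smooth_fun_on A W u" "smooth_fun_on A W v"
    and x: "x \<in> W" and c: "chart_domain A g c S" "x \<in> S"
  shows "grad_inner A g u v x = chart_domain.ip g c u v x"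
proof -
  interpret chart_domain A g c S by fact
  obtain T where T: "chart_overlap A g c (chart_at A x) T" "x \<in> T" "T \<subseteq> W"
    using overlap_at[OF W(1) x charts_at[OF c(2)] chart_at] .
  interpret O: chart_overlap A g c "chart_at A x" T by fact
  have "grad_inner A g u v x = O.dd.ip u v x"
    using O.dd.chart_domain_axioms T(2) refl by (rule grad_inner_at)
  also have "\<dots> = O.cc.ip u v x"
    using O.ip_change[of u v x] smooth_funD[OF _ O.dd.chart_domain_axioms T(3)] W T(2) by simp
  finally show ?thesis .
qed

lemma laplacian_chart:
  assumes W: "open W" "smooth_fun_on A W u"
    and x: "x \<in> W" and c: "chart_domain A g c S" "x \<in> S"
  shows "laplacian A g u x = chart_domain.L g c u x"
proof -
  interpret chart_domain A g c S by fact
  obtain T where T: "chart_overlap A g c (chart_at A x) T" "x \<in> T" "T \<subseteq> W"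
    using overlap_at[OF W(1) x charts_at[OF c(2)] chart_at] .
  interpret O: chart_overlap A g c "chart_at A x" T by fact
  have "laplacian A g u x = O.dd.L u x"
    by (simp add: laplacian_def O.dd.L_def Let_def)
  also have "\<dots> = O.cc.L u x"
    using O.laplacian_change[of u x] smooth_funD[OF _ O.dd.chart_domain_axioms T(3)]
      smooth_funD[OF _ O.cc.chart_domain_axioms T(3)] W T(2) by simp
  finally show ?thesis .
qed

text \<open>Hessian and metric transform by the same congruence, so proportionality in one chart
  carries over to every other with the same factor.\<close>

lemma hessian_conformal_chart:
  assumes W: "open W" "smooth_fun_on A W u"
    and x: "x \<in> W" and c: "c \<in> charts_at A x" and d: "d \<in> charts_at A x"
    and eq: "hessian g d u x = a *\<^sub>R g d x"
  shows "hessian g c u x = a *\<^sub>R g c x"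
proof -
  obtain T where T: "chart_overlap A g c d T" "x \<in> T" "T \<subseteq> W"
    using overlap_at[OF W(1) x c d] .
  interpret O: chart_overlap A g c d T by fact
  have "hessian g c u x = transpose (O.J x) ** (a *\<^sub>R g d x) ** O.J x"
    using O.hessian_change[of u x] smooth_funD[OF _ O.dd.chart_domain_axioms T(3)]
      smooth_funD[OF _ O.cc.chart_domain_axioms T(3)] W T(2) eq by simp
  then show ?thesis
    by (simp add: matrix_mult_scaleR O.metric_change[OF T(2)])
qed

section \<open>Smooth functions on open subsets of the manifold\<close>

lemma smooth_fun_mult:
  assumes "open W" "smooth_fun_on A W u" "smooth_fun_on A W v"
  shows "smooth_fun_on A W (\<lambda>x. u x * v x)"
  using assms(1)
proof (rule smooth_funI)
  fix c assume c: "chart_domain A g c (fst c \<inter> W)"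
  interpret chart_domain A g c "fst c \<inter> W" by fact
  show "smooth (\<lambda>x. u x * v x)"
    using smooth_funD[OF assms(2) c] smooth_funD[OF assms(3) c] by (auto intro: smooth_mult)
qed

lemma smooth_fun_add:
  assumes "open W" "smooth_fun_on A W u" "smooth_fun_on A W v"
  shows "smooth_fun_on A W (\<lambda>x. u x + v x)"
  using assms(1)
proof (rule smooth_funI)
  fix c assume c: "chart_domain A g c (fst c \<inter> W)"
  interpret chart_domain A g c "fst c \<inter> W" by fact
  show "smooth (\<lambda>x. u x + v x)"
    using smooth_funD[OF assms(2) c] smooth_funD[OF assms(3) c] by (auto intro: smooth_add)
qed

lemma smooth_fun_const: "open W \<Longrightarrow> smooth_fun_on A W (\<lambda>x. a)"
  by (rule smooth_funI) (auto intro: chart_domain.smooth_const)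

lemma smooth_fun_powr:
  assumes "open W" "smooth_fun_on A W u" "\<And>x. x \<in> W \<Longrightarrow> u x > 0"
  shows "smooth_fun_on A W (\<lambda>x. u x powr a)"
  using assms(1)
proof (rule smooth_funI)
  fix c assume c: "chart_domain A g c (fst c \<inter> W)"
  interpret chart_domain A g c "fst c \<inter> W" by fact
  show "smooth (\<lambda>x. u x powr a)"
    using smooth_funD[OF assms(2) c] assms(3) by (auto intro: smooth_powr)
qed

lemma smooth_fun_grad_inner:
  assumes "open W" "smooth_fun_on A W u" "smooth_fun_on A W v"
  shows "smooth_fun_on A W (grad_inner A g u v)"
  using assms(1)
proof (rule smooth_funI)
  fix c assume c: "chart_domain A g c (fst c \<inter> W)"
  interpret chart_domain A g c "fst c \<inter> W" by fact
  have "smooth (ip u v)"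
    using smooth_funD[OF assms(2) c] smooth_funD[OF assms(3) c] by (auto intro: smooth_ip)
  then show "smooth (grad_inner A g u v)"
    by (rule smooth_cong[THEN iffD1, rotated]) (use grad_inner_chart[OF assms _ c] in auto)
qed

end

section \<open>Rigidity for the distance-like function of the Green function\<close>

theorem proposition5p1:
  fixes A :: "('a::{t2_space, second_countable_topology}, 'n::finite) chart set"
    and g :: "('a, 'n) tensor2"
    and V :: "'a measure"
    and f G s v w \<psi> :: "'a \<Rightarrow> real"
    and m k \<kappa> :: real
    and p :: 'a
    and U :: "'a set"
  assumes manifold: "closed_riemannian_manifold A g"
    and volume: "riemannian_volume A g V"
    and dim: "CARD('n) \<ge> 3"
    and m: "m > real CARD('n)"
    and k: "k > 0"
    and \<kappa>: "\<kappa> > 0"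
    and f: "smooth_fun_on A UNIV f"
    and curvature: "\<And>x c X. c \<in> charts_at A x \<Longrightarrow>
          bilin (bakry_emery_ricci g f m c x) X X \<ge> (m - 1) * k * bilin (g c x) X X"
    and G: "positive_green_function A g V f (m * (m - 2) * k / 4) \<kappa> p G"
    and s: "s = (\<lambda>x. 1/2 * G x powr (1 / (2 - m)))"
    and v: "v = (\<lambda>x. sqrt (4 * grad_inner A g s s x + k * (s x)\<^sup>2))"
    and w: "w = (\<lambda>x. (s x)\<^sup>2)"
    and \<psi>: "\<psi> = (\<lambda>x. laplacian A g w x / real CARD('n))"
    and U: "open U" "connected U" "U \<subseteq> - {p}"
    and grad_s: "\<And>x c. x \<in> U \<Longrightarrow> c \<in> charts_at A x \<Longrightarrow> gradient g c s x \<noteq> 0"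
  defines "rigid \<equiv> (\<forall>x\<in>U.
          (\<forall>c\<in>charts_at A x. hessian g c w x = \<psi> x *\<^sub>R g c x) \<and>
          grad_inner A g f w x = - (m - real CARD('n)) * \<psi> x \<and>
          eval_grad A g (curvature_excess g f m k) w x = 0)"
  shows "((\<forall>x\<in>U. tensor_norm_sq A g (traceless_hessian A g w) x + weight_defect A g f m w x
             + eval_grad A g (curvature_excess g f m k) w x = 0) \<longleftrightarrow> rigid) \<and>
         (\<forall>\<beta> \<ge> (m - 2) / (m - 1).
            rigid \<longleftrightarrow> (\<forall>x\<in>U. drift_laplacian A g f m s (\<lambda>y. v y powr \<beta>) x = 0))"
proof -
  interpret riemannian_atlas A g
    using manifold by unfold_locales (simp_all add: closed_riemannian_manifold_def)
  define W where "W = - {p}"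
  have W: "open W" by (simp add: W_def open_Compl)
  have UW: "U \<subseteq> W" using U by (simp add: W_def)
  have m2: "m > 2" using m dim by simp
  have G_smooth: "smooth_fun_on A W G" and G_pos: "\<And>x. x \<in> W \<Longrightarrow> G x > 0"
    and G_eq: "\<And>x. x \<in> W \<Longrightarrow> laplacian A g G x - grad_inner A g f G x = m * (m - 2) * k / 4 * G x"
    using G unfolding positive_green_function_def weighted_laplacian_def W_def by auto
  have f_smooth: "smooth_fun_on A W f"
    using W
  proof (rule smooth_funI)
    fix c assume "chart_domain A g c (fst c \<inter> W)"
    then show "chart_domain.smooth c (fst c \<inter> W) f" by (rule smooth_funD[OF f]) simp
  qed
  have s_smooth: "smooth_fun_on A W s"
    unfolding s using W G_smooth G_pos by (intro smooth_fun_mult smooth_fun_const smooth_fun_powr)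
  have w_eq: "w x = 1/4 * G x powr (2 / (2 - m))" if "x \<in> W" for x
    using G_pos[OF that] by (simp add: w s power2_eq_square flip: powr_add)
  have w_smooth: "smooth_fun_on A W w"
    unfolding w power2_eq_square using W s_smooth by (intro smooth_fun_mult)
  have w_pos: "w x > 0" if "x \<in> W" for x
    using G_pos[OF that] by (simp add: w_eq[OF that])
  \<comment> \<open>\<open>F\<close> is the square of \<open>v\<close>. All differentiation is done
    on \<open>F\<close>, and \<open>v powr \<beta>\<close> enters as
    \<open>F powr (\<beta> / 2)\<close>.\<close>
  define F where "F = (\<lambda>x. 4 * grad_inner A g s s x + k * w x)"
  have F_smooth: "smooth_fun_on A W F"
    unfolding F_def using W s_smooth w_smooth
    by (intro smooth_fun_add smooth_fun_mult smooth_fun_const smooth_fun_grad_inner)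
  have main: "(tensor_norm_sq A g (traceless_hessian A g w) x + weight_defect A g f m w x
         + eval_grad A g (curvature_excess g f m k) w x = 0 \<longleftrightarrow>
        (\<forall>c\<in>charts_at A x. hessian g c w x = \<psi> x *\<^sub>R g c x) \<and>
          grad_inner A g f w x = - (m - real CARD('n)) * \<psi> x \<and>
          eval_grad A g (curvature_excess g f m k) w x = 0) \<and>
      (\<forall>\<beta> \<ge> (m - 2) / (m - 1). drift_laplacian A g f m s (\<lambda>y. v y powr \<beta>) x = 0 \<longleftrightarrow>
        tensor_norm_sq A g (traceless_hessian A g w) x + weight_defect A g f m w x
         + eval_grad A g (curvature_excess g f m k) w x = 0)" if x: "x \<in> U" for x
  proof -
    \<comment> \<open>With this chart the definitions unfold directly at \<open>x\<close>. At the
      other points of \<open>S\<close>, needed for derivatives, the choice may differ, and values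
      pass through \<open>grad_inner_chart\<close> and \<open>laplacian_chart\<close>.\<close>
    define c where "c = chart_at A x"
    define S where "S = fst c \<inter> U"
    have c: "c \<in> charts_at A x" unfolding c_def by (rule chart_at)
    then have cA: "c \<in> A" and xS: "x \<in> S" using x by (auto simp: charts_at_def S_def)
    have cd: "chart_domain A g c S"
      unfolding S_def using cA U(1) by (intro chart_domain open_Int open_chart) auto
    interpret C: chart_domain A g c S by (rule cd)
    interpret M: inner_product_matrix "g c x" by (rule C.inner_product_matrix[OF xS])
    have SW: "S \<subseteq> W" using UW by (auto simp: S_def)
    note smooth = smooth_funD[OF _ cd SW]
    note Cf = smooth[OF f_smooth] and Cw = smooth[OF w_smooth] and CF = smooth[OF F_smooth]
    have ip: "grad_inner A g u u' y = C.ip u u' y"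
      if "y \<in> S" "smooth_fun_on A W u" "smooth_fun_on A W u'" for y u u'
      using grad_inner_chart[OF W that(2,3) _ cd that(1)] SW that(1) by blast
    have F_eq: "w y * F y = C.ip w w y + k * (w y * w y)" if "y \<in> S" for y
      using C.ip_square[OF smooth[OF s_smooth] that] ip[OF that s_smooth s_smooth]
      by (simp add: F_def w algebra_simps)
    have L_w: "C.L w y = m * (F y / 2 - k * w y) + C.ip f w y" if y: "y \<in> S" for y
    proof -
      have yW: "y \<in> W" using y SW by blast
      have "C.L G y - C.ip f G y = m * (m - 2) * k / 4 * G y"
        using G_eq[OF yW] ip[OF y f_smooth G_smooth] laplacian_chart[OF W G_smooth yW cd y] by simp
      then have "w y * (C.L w y - C.ip f w y) = m / 2 * C.ip w w y - m / 2 * k * (w y * w y)"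
        using C.green_power[OF smooth[OF G_smooth] Cf, of y w m k] G_pos w_eq SW y m2 by blast
      also have "\<dots> = w y * (m * (F y / 2 - k * w y))"
        using F_eq[OF y] by (simp add: algebra_simps)
      finally show ?thesis using w_pos[OF yW] by simp
    qed
    have w_pos': "w y > 0" if "y \<in> S" for y using w_pos that SW by blast
    note hyps = Cf Cw CF w_pos' F_eq L_w m
    define N where "N = real CARD('n)"
    have N: "N > 0" "m > N" using m by (simp_all add: N_def)
    define tn where "tn = tensor_norm_sq A g (traceless_hessian A g w) x"
    define wd where "wd = weight_defect A g f m w x"
    define ex where "ex = eval_grad A g (curvature_excess g f m k) w x"
    have lap: "laplacian A g w x = C.L w x"
      by (simp add: laplacian_def c_def[symmetric] C.L_def Let_def)
    have gi: "grad_inner A g u u' x = C.ip u u' x" for u u'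
      by (rule grad_inner_at[OF cd xS c_def])
    have traceless: "traceless_hessian A g w c x = M.traceless (hessian g c w x)"
      by (simp add: traceless_hessian_def M.traceless_def M.tr_def lap C.L_trace[OF Cw xS])
    have tn: "tn = tensor_norm (matrix_inv (g c x)) (M.traceless (hessian g c w x))"
      by (simp add: tn_def tensor_norm_sq_def tensor_norm_def Let_def c_def[symmetric] traceless)
    have sym: "transpose (M.traceless (hessian g c w x)) = M.traceless (hessian g c w x)"
      by (rule M.traceless_transpose[OF C.hessian_transpose[OF Cw xS]])
    have wd: "wd = N / (m * (m - N)) * ((m - N) / N * C.L w x + C.ip f w x)\<^sup>2"
      by (simp add: wd_def weight_defect_def Let_def lap gi N_def)
    have ex: "ex = bilin (curvature_excess g f m k c x) (gradient g c w x) (gradient g c w x)"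
      by (simp add: ex_def eval_grad_def Let_def c_def)
    have Q: "tn + wd + ex = C.rigidity_defect f m k w x"
      by (simp add: C.rigidity_defect_def tn wd ex N_def)
    have nonneg: "tn \<ge> 0" "wd \<ge> 0" "ex \<ge> 0"
    proof -
      show "tn \<ge> 0" unfolding tn by (rule M.tensor_norm_nonneg[OF sym])
      show "wd \<ge> 0" unfolding wd using N by simp
      show "ex \<ge> 0"
        using curvature[OF c, of "gradient g c w x"]
        by (simp add: ex curvature_excess_def bilin_def matrix_vector_mult_diff_rdistrib
            scaleR_matrix_vector_assoc[symmetric] inner_diff_right)
    qed
    have rigid: "tn + wd + ex = 0 \<longleftrightarrow>
        (\<forall>c\<in>charts_at A x. hessian g c w x = \<psi> x *\<^sub>R g c x) \<and>
          grad_inner A g f w x = - (m - N) * \<psi> x \<and> ex = 0"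
    proof -
      have "tn = 0 \<longleftrightarrow> M.traceless (hessian g c w x) = 0"
        unfolding tn using M.tensor_norm_eq_0[OF sym] by (auto simp: tensor_norm_def)
      also have "\<dots> \<longleftrightarrow> hessian g c w x = \<psi> x *\<^sub>R g c x"
        by (simp add: traceless[symmetric] traceless_hessian_def \<psi>)
      also have "\<dots> \<longleftrightarrow> (\<forall>c\<in>charts_at A x. hessian g c w x = \<psi> x *\<^sub>R g c x)"
        using hessian_conformal_chart[OF W w_smooth _ _ c] c x UW by blast
      finally have 1: "tn = 0 \<longleftrightarrow> (\<forall>c\<in>charts_at A x. hessian g c w x = \<psi> x *\<^sub>R g c x)" .
      have "wd = 0 \<longleftrightarrow> (m - N) / N * C.L w x + C.ip f w x = 0"
        unfolding wd using N by simp
      also have "\<dots> \<longleftrightarrow> grad_inner A g f w x = - (m - N) * \<psi> x"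
      proof -
        have "- (m - N) * (C.L w x / N) = - ((m - N) / N * C.L w x)"
          using N by (simp add: field_simps)
        then show ?thesis unfolding gi \<psi> lap N_def[symmetric] by linarith
      qed
      finally show ?thesis using 1 nonneg by auto
    qed
    have drift: "drift_laplacian A g f m s (\<lambda>y. v y powr \<beta>) x = 0 \<longleftrightarrow> tn + wd + ex = 0"
      if \<beta>: "\<beta> \<ge> (m - 2) / (m - 1)" for \<beta>
    proof -
      have F_pos: "F y > 0" if "y \<in> S" for y
        using C.F_pos[OF hyps that k] .
      have vF: "v y powr \<beta> = F y powr (\<beta> / 2)" if "y \<in> S" for y
      proof -
        have "v y = F y powr (1 / 2)"
          using F_pos[OF that] by (simp add: v F_def w powr_half_sqrt)
        then show ?thesis by (simp add: powr_powr)
      qed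
      \<comment> \<open>Agreement on the open set \<open>S\<close> transfers all derivatives at
        \<open>x\<close>, so those of \<open>v\<close> itself never have to be computed.\<close>
      have "C.D i (\<lambda>y. v y powr \<beta>) x = C.D i (\<lambda>y. F y powr (\<beta> / 2)) x" for i
        using xS vF by (rule C.D_cong)
      then have ipv: "C.ip u (\<lambda>y. v y powr \<beta>) x = C.ip u (\<lambda>y. F y powr (\<beta> / 2)) x" for u
        by (simp add: C.ip_sum)
      have "C.L (\<lambda>y. v y powr \<beta>) x = C.L (\<lambda>y. F y powr (\<beta> / 2)) x"
        using xS vF by (rule C.L_cong)
      moreover have "laplacian A g (\<lambda>y. v y powr \<beta>) x = C.L (\<lambda>y. v y powr \<beta>) x"
        by (simp add: laplacian_def c_def[symmetric] C.L_def Let_def)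
      ultimately have "drift_laplacian A g f m s (\<lambda>y. v y powr \<beta>) x
          = C.L (\<lambda>y. F y powr (\<beta> / 2)) x - C.ip f (\<lambda>y. F y powr (\<beta> / 2)) x
            + (2 - m) / w x * C.ip w (\<lambda>y. F y powr (\<beta> / 2)) x"
        by (simp add: drift_laplacian_def weighted_laplacian_def gi ipv w)
      also have "\<dots> = 0 \<longleftrightarrow> C.rigidity_defect f m k w x = 0"
        using nonneg \<beta> dim by (intro C.drift_F_powr_eq_0_iff[OF hyps xS _ k]) (simp_all add: Q[symmetric] ex)
      finally show ?thesis by (simp add: Q)
    qed
    show ?thesis
      using rigid drift unfolding tn_def wd_def ex_def N_def by blast
  qed
  then show ?thesis unfolding rigid_def by blast
qed

end
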